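(* Let $(\mathcal{V},\otimes,I,a,\ell,r)$ be a left skew monoidal category, $(\mathcal{A},*,m,u)$ a strong left $\mathcal{V}$-action, $J\in\mathcal{A}$ an object, and $J_*:\mathcal{V}\to\mathcal{A}$ the functor $J_*X=X*J$. (i) Suppose $J_*$ has a left adjoint $J_!$, and let $(\mathcal{A},\lhd,J)$ be the induced left skew monoidal category with tensor $A\lhd B=J_!A*B$. If the action is left closed, then $(\mathcal{A},\lhd,J)$ is left closed, with $\llbracket B,-\rrbracket=J_*B_\#$. If the action is right closed, then $(\mathcal{A},\lhd,J)$ is right closed, with $\llbracket A,-\rrbracket=\llbracket J_!A,-\rrbracket_*$. (ii) Suppose $J_*$ has a right adjoint $J_\#$, and let $(\mathcal{A},\lhd,J)$ be the induced right skew monoidal category with tensor $A\lhd B=J_\#A*B$. If the action is left closed and in addition the functor $J_\#:\mathcal{A}\to\mathcal{V}$ has a right adjoint $R_J:\mathcal{V}\to\mathcal{A}$, then $(\mathcal{A},\lhd,J)$ is left closed, with $\llbracket B,-\rrbracket=R_JB_\#$. If the action is right closed, then $(\mathcal{A},\lhd,J)$ is right closed, with $\llbracket A,-\rrbracket=\llbracket J_\#A,-\rrbracket_*$.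
   Context: A left skew monoidal category $(\mathcal{A}, \otimes, I, \gamma,\lambda,\rho)$ consists of a category $\mathcal{A}$, a functor $\otimes : \mathcal{A}\times\mathcal{A}\to\mathcal{A}$, an object $I$, and natural families of (not necessarily invertible) morphisms $\gamma_{A,B,C} : (A\otimes B)\otimes C \to A\otimes(B\otimes C)$, $\lambda_A : I\otimes A\to A$, $\rho_A : A\to A\otimes I$ such that $(A\otimes\gamma_{B,C,D})\circ\gamma_{A,B\otimes C,D}\circ(\gamma_{A,B,C}\otimes D)=\gamma_{A,B,C\otimes D}\circ\gamma_{A\otimes B,C,D}$; $\gamma_{A,B,I}\circ\rho_{A\otimes B}=A\otimes\rho_B$; $\lambda_{A\otimes B}\circ\gamma_{I,A,B}=\lambda_A\otimes B$; $\lambda_I\circ\rho_I=\mathrm{id}_I$; $(A\otimes\lambda_B)\circ\gamma_{A,I,B}\circ(\rho_A\otimes B)=\mathrm{id}_{A\otimes B}$. A right skew monoidal category is defined by reversing all the arrows (constraints $A\otimes(B\otimes C)\to(A\otimes B)\otimes C$, $A\to I\otimes A$, $A\otimes I\to A$, with the five axioms reversed). A strong left action of a left skew monoidal category $(\mathcal{V},\otimes,I,a,\ell,r)$ on a category $\mathcal{A}$ is a bifunctor $* : \mathcal{V}\times\mathcal{A}\to\mathcal{A}$ with natural isomorphisms $m^{X,Y}_A : (X\otimes Y)*A\to X*(Y*A)$ and $u_A : I*A\to A$ such that $(X*m^{Y,Z}_A)\circ m^{X,Y\otimes Z}_A\circ(a_{X,Y,Z}*A)=m^{X,Y}_{Z*A}\circ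 m^{X\otimes Y,Z}_A$; $u_{X*A}\circ m^{I,X}_A=\ell_X*A$; $(X*u_A)\circ m^{X,I}_A\circ(r_X*A)=\mathrm{id}_{X*A}$. Induced structure for $J_!\dashv J_*$ (unit $\eta$, counit $\epsilon$): tensor $A\lhd B=J_!A*B$, unit $J$, $\gamma_{A,B,C}=m^{J_!A,J_!B}_C\circ(\tilde\gamma_{A,B}*C)$, $\lambda_A=u_A\circ(\epsilon_I*A)\circ(J_!(u_J^{-1})*A)$, $\rho_A=\eta_A$, where $\tilde\gamma_{A,B}:J_!(J_!A*B)\to J_!A\otimes J_!B$ is the adjoint transpose of $(m^{J_!A,J_!B}_J)^{-1}\circ(J_!A*\eta_B)$; this is left skew monoidal. Induced structure for $J_*\dashv J_\#$ (unit $\eta$, counit $\epsilon$): tensor $A\lhd B=J_\#A*B$, unit $J$, associator $(\tilde\gamma_{A,B}*C)\circ(m^{J_\#A,J_\#B}_C)^{-1}:J_\#A*(J_\#B*C)\to J_\#(J_\#A*B)*C$, where $\tilde\gamma_{A,B}:J_\#A\otimes J_\#B\to J_\#(J_\#A*B)$ is the adjoint transpose of $(J_\#A*\epsilon_B)\circ m^{J_\#A,J_\#B}_J$; left unitor $(J_\#(u_J)*A)\circ(\eta_I*A)\circ u_A^{-1}:A\to J_\#J*A$; right unitor $\epsilon_A:J_\#A*J\to A$; this is right skew monoidal. A skew monoidal structure $(\mathcal{A},\lhd,J)$ is right closed if for every $A\in\mathcal{A}$ the functor $A\lhd(-)$ has a right adjoint, denoted $\llbracket A,-\rrbracket$; it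 is left closed if for every $B\in\mathcal{A}$ the functor $(-)\lhd B$ has a right adjoint, denoted $\llbracket B,-\rrbracket$. The action is left closed if for every $B\in\mathcal{A}$ the functor $B_*=(-)*B:\mathcal{V}\to\mathcal{A}$ has a right adjoint, denoted $B_\#:\mathcal{A}\to\mathcal{V}$. The action is right closed if for every $X\in\mathcal{V}$ the functor $X*(-):\mathcal{A}\to\mathcal{A}$ has a right adjoint, denoted $\llbracket X,-\rrbracket_*$. Juxtaposition of functors denotes composition, e.g. $J_*B_\#(C)=J_*(B_\#(C))$. *)

theory Defs
  imports Main
begin

section \<open>Categories, functors, natural transformations\<close>

record ('o, 'a) cat =
  Obj  :: "'o set"
  Arr  :: "'a set"
  Dom  :: "'a \<Rightarrow> 'o"
  Cod  :: "'a \<Rightarrow> 'o"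
  Id   :: "'o \<Rightarrow> 'a"
  Comp :: "'a \<Rightarrow> 'a \<Rightarrow> 'a"  (infixr "\<cdot>\<index>" 55)

definition hom :: "('o, 'a) cat \<Rightarrow> 'o \<Rightarrow> 'o \<Rightarrow> 'a set" where
  "hom C a b = {f \<in> Arr C. Dom C f = a \<and> Cod C f = b}"

text \<open>
  Composition is written in applicative order: \<open>g \<cdot>\<^bsub>C\<^esub> f\<close> is \<open>g\<close> after \<open>f\<close>.  All maps are total
  functions of the logic; their values outside the carriers \<open>Obj C\<close>, \<open>Arr C\<close> (and the value of
  \<open>Comp C\<close> on non-composable pairs) are unconstrained and never used.
\<close>

locale category =
  fixes C :: "('o, 'a) cat" (structure)
  assumes Dom_in: "f \<in> Arr C \<Longrightarrow> Dom C f \<in> Obj C"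
    and Cod_in: "f \<in> Arr C \<Longrightarrow> Cod C f \<in> Obj C"
    and Id_in: "a \<in> Obj C \<Longrightarrow> Id C a \<in> hom C a a"
    and Comp_in: "f \<in> hom C a b \<Longrightarrow> g \<in> hom C b c \<Longrightarrow> g \<cdot> f \<in> hom C a c"
    and Id_left: "f \<in> hom C a b \<Longrightarrow> Id C b \<cdot> f = f"
    and Id_right: "f \<in> hom C a b \<Longrightarrow> f \<cdot> Id C a = f"
    and Comp_assoc: "f \<in> hom C a b \<Longrightarrow> g \<in> hom C b c \<Longrightarrow> h \<in> hom C c d \<Longrightarrow>
      (h \<cdot> g) \<cdot> f = h \<cdot> (g \<cdot> f)"

definition inverse_arrows :: "('o, 'a) cat \<Rightarrow> 'a \<Rightarrow> 'a \<Rightarrow> bool" where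
  "inverse_arrows C f g \<longleftrightarrow> f \<in> Arr C \<and> g \<in> hom C (Cod C f) (Dom C f) \<and>
     g \<cdot>\<^bsub>C\<^esub> f = Id C (Dom C f) \<and> f \<cdot>\<^bsub>C\<^esub> g = Id C (Cod C f)"

definition iso_arr :: "('o, 'a) cat \<Rightarrow> 'a \<Rightarrow> bool" where
  "iso_arr C f \<longleftrightarrow> (\<exists>g. inverse_arrows C f g)"

definition inv_arr :: "('o, 'a) cat \<Rightarrow> 'a \<Rightarrow> 'a" where
  "inv_arr C f = (THE g. inverse_arrows C f g)"

definition prod_cat ::
  "('o1, 'a1) cat \<Rightarrow> ('o2, 'a2) cat \<Rightarrow> ('o1 \<times> 'o2, 'a1 \<times> 'a2) cat" where
  "prod_cat C D =
    \<lparr>Obj = Obj C \<times> Obj D,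
     Arr = Arr C \<times> Arr D,
     Dom = (\<lambda>(f, g). (Dom C f, Dom D g)),
     Cod = (\<lambda>(f, g). (Cod C f, Cod D g)),
     Id = (\<lambda>(a, b). (Id C a, Id D b)),
     Comp = (\<lambda>(f', g') (f, g). (f' \<cdot>\<^bsub>C\<^esub> f, g' \<cdot>\<^bsub>D\<^esub> g))\<rparr>"

record ('o1, 'a1, 'o2, 'a2) fctr =
  OMap :: "'o1 \<Rightarrow> 'o2"
  AMap :: "'a1 \<Rightarrow> 'a2"

locale is_functor = C: category C + D: category D
  for C :: "('o1, 'a1) cat" and D :: "('o2, 'a2) cat" +
  fixes F :: "('o1, 'a1, 'o2, 'a2) fctr"
  assumes OMap_in: "a \<in> Obj C \<Longrightarrow> OMap F a \<in> Obj D"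
    and AMap_in: "f \<in> hom C a b \<Longrightarrow> AMap F f \<in> hom D (OMap F a) (OMap F b)"
    and AMap_Id: "a \<in> Obj C \<Longrightarrow> AMap F (Id C a) = Id D (OMap F a)"
    and AMap_Comp: "f \<in> hom C a b \<Longrightarrow> g \<in> hom C b c \<Longrightarrow>
      AMap F (g \<cdot>\<^bsub>C\<^esub> f) = AMap F g \<cdot>\<^bsub>D\<^esub> AMap F f"

definition id_fctr :: "('o, 'a, 'o, 'a) fctr" where
  "id_fctr = \<lparr>OMap = (\<lambda>a. a), AMap = (\<lambda>f. f)\<rparr>"

definition comp_fctr ::
  "('o2, 'a2, 'o3, 'a3) fctr \<Rightarrow> ('o1, 'a1, 'o2, 'a2) fctr \<Rightarrow> ('o1, 'a1, 'o3, 'a3) fctr"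
  (infixr "\<circ>\<^sub>F" 55) where
  "G \<circ>\<^sub>F F = \<lparr>OMap = (\<lambda>a. OMap G (OMap F a)), AMap = (\<lambda>f. AMap G (AMap F f))\<rparr>"

text \<open>The functors \<open>F(a, -)\<close> and \<open>F(-, b)\<close> for a bifunctor \<open>F\<close> on \<open>C \<times> D\<close>.\<close>

definition fix_fst ::
  "('o1, 'a1) cat \<Rightarrow> ('o1 \<times> 'o2, 'a1 \<times> 'a2, 'o3, 'a3) fctr \<Rightarrow> 'o1 \<Rightarrow> ('o2, 'a2, 'o3, 'a3) fctr" where
  "fix_fst C F a = \<lparr>OMap = (\<lambda>b. OMap F (a, b)), AMap = (\<lambda>g. AMap F (Id C a, g))\<rparr>"

definition fix_snd ::
  "('o2, 'a2) cat \<Rightarrow> ('o1 \<times> 'o2, 'a1 \<times> 'a2, 'o3, 'a3) fctr \<Rightarrow> 'o2 \<Rightarrow> ('o1, 'a1, 'o3, 'a3) fctr" where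
  "fix_snd D F b = \<lparr>OMap = (\<lambda>a. OMap F (a, b)), AMap = (\<lambda>f. AMap F (f, Id D b))\<rparr>"

locale nat_trans = F: is_functor C D F + G: is_functor C D G
  for C :: "('o1, 'a1) cat" and D :: "('o2, 'a2) cat" and F G +
  fixes \<tau> :: "'o1 \<Rightarrow> 'a2"
  assumes component_in: "a \<in> Obj C \<Longrightarrow> \<tau> a \<in> hom D (OMap F a) (OMap G a)"
    and naturality: "f \<in> hom C a b \<Longrightarrow> \<tau> b \<cdot>\<^bsub>D\<^esub> AMap F f = AMap G f \<cdot>\<^bsub>D\<^esub> \<tau> a"

text \<open>\<open>adjunction C D F G \<eta> \<epsilon>\<close>: the functor \<open>F : C \<rightarrow> D\<close> is left adjoint to \<open>G : D \<rightarrow> C\<close>.\<close>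

locale adjunction =
  F: is_functor C D F + G: is_functor D C G +
  unit: nat_trans C C id_fctr "G \<circ>\<^sub>F F" \<eta> + counit: nat_trans D D "F \<circ>\<^sub>F G" id_fctr \<epsilon>
  for C :: "('o1, 'a1) cat" and D :: "('o2, 'a2) cat" and F G \<eta> \<epsilon> +
  assumes triangle_left: "a \<in> Obj C \<Longrightarrow> \<epsilon> (OMap F a) \<cdot>\<^bsub>D\<^esub> AMap F (\<eta> a) = Id D (OMap F a)"
    and triangle_right: "x \<in> Obj D \<Longrightarrow> AMap G (\<epsilon> x) \<cdot>\<^bsub>C\<^esub> \<eta> (OMap G x) = Id C (OMap G x)"

definition right_adjoint ::
  "('o1, 'a1) cat \<Rightarrow> ('o2, 'a2) cat \<Rightarrow> ('o1, 'a1, 'o2, 'a2) fctr \<Rightarrow> ('o2, 'a2, 'o1, 'a1) fctr \<Rightarrow> bool"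
  where "right_adjoint C D F G \<longleftrightarrow> (\<exists>\<eta> \<epsilon>. adjunction C D F G \<eta> \<epsilon>)"

text \<open>
  Adjoint transposes for \<open>F \<stileturn> G\<close>: \<open>g : a \<rightarrow> G x\<close> corresponds to \<open>F a \<rightarrow> x\<close>, and
  \<open>f : F a \<rightarrow> x\<close> corresponds to \<open>a \<rightarrow> G x\<close>.
\<close>

definition transpose_left ::
  "('o2, 'a2) cat \<Rightarrow> ('o1, 'a1, 'o2, 'a2) fctr \<Rightarrow> ('o2 \<Rightarrow> 'a2) \<Rightarrow> 'o2 \<Rightarrow> 'a1 \<Rightarrow> 'a2" where
  "transpose_left D F \<epsilon> x g = \<epsilon> x \<cdot>\<^bsub>D\<^esub> AMap F g"

definition transpose_right ::
  "('o1, 'a1) cat \<Rightarrow> ('o2, 'a2, 'o1, 'a1) fctr \<Rightarrow> ('o1 \<Rightarrow> 'a1) \<Rightarrow> 'o1 \<Rightarrow> 'a2 \<Rightarrow> 'a1" where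
  "transpose_right C G \<eta> a f = AMap G f \<cdot>\<^bsub>C\<^esub> \<eta> a"


section \<open>Skew monoidal categories\<close>

record ('o, 'a) skew =
  Tensor :: "('o \<times> 'o, 'a \<times> 'a, 'o, 'a) fctr"
  Unit   :: 'o
  Assoc  :: "'o \<Rightarrow> 'o \<Rightarrow> 'o \<Rightarrow> 'a"
  Lunit  :: "'o \<Rightarrow> 'a"
  Runit  :: "'o \<Rightarrow> 'a"

text \<open>\<open>\<otimes>\<close> is the tensor on objects and \<open>\<boxtimes>\<close> the same functor on arrows.\<close>

abbreviation tensor_obj :: "('o, 'a) skew \<Rightarrow> 'o \<Rightarrow> 'o \<Rightarrow> 'o" (infixr "\<otimes>\<index>" 70) where
  "x \<otimes>\<^bsub>S\<^esub> y \<equiv> OMap (Tensor S) (x, y)"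

abbreviation tensor_arr :: "('o, 'a) skew \<Rightarrow> 'a \<Rightarrow> 'a \<Rightarrow> 'a" (infixr "\<boxtimes>\<index>" 70) where
  "f \<boxtimes>\<^bsub>S\<^esub> g \<equiv> AMap (Tensor S) (f, g)"

locale skew_data = category C + tensor: is_functor "prod_cat C C" C "Tensor S"
  for C :: "('o, 'a) cat" and S :: "('o, 'a) skew" +
  assumes Unit_in: "Unit S \<in> Obj C"

locale left_skew_monoidal = skew_data C S
  for C :: "('o, 'a) cat" and S :: "('o, 'a) skew" +
  assumes Assoc_in: "\<lbrakk>x \<in> Obj C; y \<in> Obj C; z \<in> Obj C\<rbrakk> \<Longrightarrow>
      Assoc S x y z \<in> hom C ((x \<otimes>\<^bsub>S\<^esub> y) \<otimes>\<^bsub>S\<^esub> z) (x \<otimes>\<^bsub>S\<^esub> (y \<otimes>\<^bsub>S\<^esub> z))"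
    and Assoc_natural: "\<lbrakk>f \<in> hom C x x'; g \<in> hom C y y'; h \<in> hom C z z'\<rbrakk> \<Longrightarrow>
      Assoc S x' y' z' \<cdot>\<^bsub>C\<^esub> ((f \<boxtimes>\<^bsub>S\<^esub> g) \<boxtimes>\<^bsub>S\<^esub> h) = (f \<boxtimes>\<^bsub>S\<^esub> (g \<boxtimes>\<^bsub>S\<^esub> h)) \<cdot>\<^bsub>C\<^esub> Assoc S x y z"
    and Lunit_natural: "nat_trans C C (fix_fst C (Tensor S) (Unit S)) id_fctr (Lunit S)"
    and Runit_natural: "nat_trans C C id_fctr (fix_snd C (Tensor S) (Unit S)) (Runit S)"
    and pentagon: "\<lbrakk>w \<in> Obj C; x \<in> Obj C; y \<in> Obj C; z \<in> Obj C\<rbrakk> \<Longrightarrow>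
      (Id C w \<boxtimes>\<^bsub>S\<^esub> Assoc S x y z) \<cdot>\<^bsub>C\<^esub> Assoc S w (x \<otimes>\<^bsub>S\<^esub> y) z \<cdot>\<^bsub>C\<^esub> (Assoc S w x y \<boxtimes>\<^bsub>S\<^esub> Id C z)
        = Assoc S w x (y \<otimes>\<^bsub>S\<^esub> z) \<cdot>\<^bsub>C\<^esub> Assoc S (w \<otimes>\<^bsub>S\<^esub> x) y z"
    and Assoc_Runit: "\<lbrakk>x \<in> Obj C; y \<in> Obj C\<rbrakk> \<Longrightarrow>
      Assoc S x y (Unit S) \<cdot>\<^bsub>C\<^esub> Runit S (x \<otimes>\<^bsub>S\<^esub> y) = Id C x \<boxtimes>\<^bsub>S\<^esub> Runit S y"
    and Lunit_Assoc: "\<lbrakk>x \<in> Obj C; y \<in> Obj C\<rbrakk> \<Longrightarrow>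
      Lunit S (x \<otimes>\<^bsub>S\<^esub> y) \<cdot>\<^bsub>C\<^esub> Assoc S (Unit S) x y = Lunit S x \<boxtimes>\<^bsub>S\<^esub> Id C y"
    and Lunit_Runit: "Lunit S (Unit S) \<cdot>\<^bsub>C\<^esub> Runit S (Unit S) = Id C (Unit S)"
    and triangle: "\<lbrakk>x \<in> Obj C; y \<in> Obj C\<rbrakk> \<Longrightarrow>
      (Id C x \<boxtimes>\<^bsub>S\<^esub> Lunit S y) \<cdot>\<^bsub>C\<^esub> Assoc S x (Unit S) y \<cdot>\<^bsub>C\<^esub> (Runit S x \<boxtimes>\<^bsub>S\<^esub> Id C y)
        = Id C (x \<otimes>\<^bsub>S\<^esub> y)"

locale right_skew_monoidal = skew_data C S
  for C :: "('o, 'a) cat" and S :: "('o, 'a) skew" +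
  assumes Assoc_in: "\<lbrakk>x \<in> Obj C; y \<in> Obj C; z \<in> Obj C\<rbrakk> \<Longrightarrow>
      Assoc S x y z \<in> hom C (x \<otimes>\<^bsub>S\<^esub> (y \<otimes>\<^bsub>S\<^esub> z)) ((x \<otimes>\<^bsub>S\<^esub> y) \<otimes>\<^bsub>S\<^esub> z)"
    and Assoc_natural: "\<lbrakk>f \<in> hom C x x'; g \<in> hom C y y'; h \<in> hom C z z'\<rbrakk> \<Longrightarrow>
      Assoc S x' y' z' \<cdot>\<^bsub>C\<^esub> (f \<boxtimes>\<^bsub>S\<^esub> (g \<boxtimes>\<^bsub>S\<^esub> h)) = ((f \<boxtimes>\<^bsub>S\<^esub> g) \<boxtimes>\<^bsub>S\<^esub> h) \<cdot>\<^bsub>C\<^esub> Assoc S x y z"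
    and Lunit_natural: "nat_trans C C id_fctr (fix_fst C (Tensor S) (Unit S)) (Lunit S)"
    and Runit_natural: "nat_trans C C (fix_snd C (Tensor S) (Unit S)) id_fctr (Runit S)"
    and pentagon: "\<lbrakk>w \<in> Obj C; x \<in> Obj C; y \<in> Obj C; z \<in> Obj C\<rbrakk> \<Longrightarrow>
      (Assoc S w x y \<boxtimes>\<^bsub>S\<^esub> Id C z) \<cdot>\<^bsub>C\<^esub> Assoc S w (x \<otimes>\<^bsub>S\<^esub> y) z \<cdot>\<^bsub>C\<^esub> (Id C w \<boxtimes>\<^bsub>S\<^esub> Assoc S x y z)
        = Assoc S (w \<otimes>\<^bsub>S\<^esub> x) y z \<cdot>\<^bsub>C\<^esub> Assoc S w x (y \<otimes>\<^bsub>S\<^esub> z)"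
    and Runit_Assoc: "\<lbrakk>x \<in> Obj C; y \<in> Obj C\<rbrakk> \<Longrightarrow>
      Runit S (x \<otimes>\<^bsub>S\<^esub> y) \<cdot>\<^bsub>C\<^esub> Assoc S x y (Unit S) = Id C x \<boxtimes>\<^bsub>S\<^esub> Runit S y"
    and Assoc_Lunit: "\<lbrakk>x \<in> Obj C; y \<in> Obj C\<rbrakk> \<Longrightarrow>
      Assoc S (Unit S) x y \<cdot>\<^bsub>C\<^esub> Lunit S (x \<otimes>\<^bsub>S\<^esub> y) = Lunit S x \<boxtimes>\<^bsub>S\<^esub> Id C y"
    and Runit_Lunit: "Runit S (Unit S) \<cdot>\<^bsub>C\<^esub> Lunit S (Unit S) = Id C (Unit S)"
    and triangle: "\<lbrakk>x \<in> Obj C; y \<in> Obj C\<rbrakk> \<Longrightarrow>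
      (Runit S x \<boxtimes>\<^bsub>S\<^esub> Id C y) \<cdot>\<^bsub>C\<^esub> Assoc S x (Unit S) y \<cdot>\<^bsub>C\<^esub> (Id C x \<boxtimes>\<^bsub>S\<^esub> Lunit S y)
        = Id C (x \<otimes>\<^bsub>S\<^esub> y)"

definition skew_left_closed :: "('o, 'a) cat \<Rightarrow> ('o, 'a) skew \<Rightarrow> bool" where
  "skew_left_closed C S \<longleftrightarrow> (\<forall>b \<in> Obj C. \<exists>H. right_adjoint C C (fix_snd C (Tensor S) b) H)"

definition skew_right_closed :: "('o, 'a) cat \<Rightarrow> ('o, 'a) skew \<Rightarrow> bool" where
  "skew_right_closed C S \<longleftrightarrow> (\<forall>a \<in> Obj C. \<exists>H. right_adjoint C C (fix_fst C (Tensor S) a) H)"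


section \<open>Strong left actions\<close>

record ('vo, 'va, 'o, 'a) action =
  Act   :: "('vo \<times> 'o, 'va \<times> 'a, 'o, 'a) fctr"
  Mult  :: "'vo \<Rightarrow> 'vo \<Rightarrow> 'o \<Rightarrow> 'a"
  Unitor :: "'o \<Rightarrow> 'a"

text \<open>\<open>\<star>\<close> is the action on objects and \<open>\<bullet>\<close> the same functor on arrows.\<close>

abbreviation act_obj :: "('vo, 'va, 'o, 'a) action \<Rightarrow> 'vo \<Rightarrow> 'o \<Rightarrow> 'o" (infixr "\<star>\<index>" 70) where
  "x \<star>\<^bsub>T\<^esub> a \<equiv> OMap (Act T) (x, a)"

abbreviation act_arr :: "('vo, 'va, 'o, 'a) action \<Rightarrow> 'va \<Rightarrow> 'a \<Rightarrow> 'a" (infixr "\<bullet>\<index>" 70) where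
  "f \<bullet>\<^bsub>T\<^esub> g \<equiv> AMap (Act T) (f, g)"

locale strong_left_action =
  V: left_skew_monoidal V S + A: category A + act: is_functor "prod_cat V A" A "Act T"
  for V :: "('vo, 'va) cat" and S :: "('vo, 'va) skew" and A :: "('o, 'a) cat"
    and T :: "('vo, 'va, 'o, 'a) action" +
  assumes Mult_in: "\<lbrakk>x \<in> Obj V; y \<in> Obj V; a \<in> Obj A\<rbrakk> \<Longrightarrow>
      Mult T x y a \<in> hom A ((x \<otimes>\<^bsub>S\<^esub> y) \<star>\<^bsub>T\<^esub> a) (x \<star>\<^bsub>T\<^esub> (y \<star>\<^bsub>T\<^esub> a))"
    and Mult_iso: "\<lbrakk>x \<in> Obj V; y \<in> Obj V; a \<in> Obj A\<rbrakk> \<Longrightarrow> iso_arr A (Mult T x y a)"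
    and Mult_natural: "\<lbrakk>f \<in> hom V x x'; g \<in> hom V y y'; h \<in> hom A a a'\<rbrakk> \<Longrightarrow>
      Mult T x' y' a' \<cdot>\<^bsub>A\<^esub> ((f \<boxtimes>\<^bsub>S\<^esub> g) \<bullet>\<^bsub>T\<^esub> h) = (f \<bullet>\<^bsub>T\<^esub> (g \<bullet>\<^bsub>T\<^esub> h)) \<cdot>\<^bsub>A\<^esub> Mult T x y a"
    and Unitor_natural: "nat_trans A A (fix_fst V (Act T) (Unit S)) id_fctr (Unitor T)"
    and Unitor_iso: "a \<in> Obj A \<Longrightarrow> iso_arr A (Unitor T a)"
    and Mult_Assoc: "\<lbrakk>x \<in> Obj V; y \<in> Obj V; z \<in> Obj V; a \<in> Obj A\<rbrakk> \<Longrightarrow>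
      (Id V x \<bullet>\<^bsub>T\<^esub> Mult T y z a) \<cdot>\<^bsub>A\<^esub> Mult T x (y \<otimes>\<^bsub>S\<^esub> z) a \<cdot>\<^bsub>A\<^esub> (Assoc S x y z \<bullet>\<^bsub>T\<^esub> Id A a)
        = Mult T x y (z \<star>\<^bsub>T\<^esub> a) \<cdot>\<^bsub>A\<^esub> Mult T (x \<otimes>\<^bsub>S\<^esub> y) z a"
    and Unitor_Mult: "\<lbrakk>x \<in> Obj V; a \<in> Obj A\<rbrakk> \<Longrightarrow>
      Unitor T (x \<star>\<^bsub>T\<^esub> a) \<cdot>\<^bsub>A\<^esub> Mult T (Unit S) x a = Lunit S x \<bullet>\<^bsub>T\<^esub> Id A a"
    and Mult_Runit: "\<lbrakk>x \<in> Obj V; a \<in> Obj A\<rbrakk> \<Longrightarrow>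
      (Id V x \<bullet>\<^bsub>T\<^esub> Unitor T a) \<cdot>\<^bsub>A\<^esub> Mult T x (Unit S) a \<cdot>\<^bsub>A\<^esub> (Runit S x \<bullet>\<^bsub>T\<^esub> Id A a)
        = Id A (x \<star>\<^bsub>T\<^esub> a)"

text \<open>The functor \<open>b\<^sub>* = (-) * b\<close> from \<open>V\<close> to \<open>A\<close>; the functor \<open>J\<^sub>*\<close> is the case \<open>b = J\<close>.\<close>

definition act_on :: "('o, 'a) cat \<Rightarrow> ('vo, 'va, 'o, 'a) action \<Rightarrow> 'o \<Rightarrow> ('vo, 'va, 'o, 'a) fctr" where
  "act_on A T b = fix_snd A (Act T) b"

definition act_by :: "('vo, 'va) cat \<Rightarrow> ('vo, 'va, 'o, 'a) action \<Rightarrow> 'vo \<Rightarrow> ('o, 'a, 'o, 'a) fctr" where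
  "act_by V T x = fix_fst V (Act T) x"

definition action_left_closed ::
  "('vo, 'va) cat \<Rightarrow> ('o, 'a) cat \<Rightarrow> ('vo, 'va, 'o, 'a) action \<Rightarrow> bool" where
  "action_left_closed V A T \<longleftrightarrow> (\<forall>b \<in> Obj A. \<exists>G. right_adjoint V A (act_on A T b) G)"

definition action_right_closed ::
  "('vo, 'va) cat \<Rightarrow> ('o, 'a) cat \<Rightarrow> ('vo, 'va, 'o, 'a) action \<Rightarrow> bool" where
  "action_right_closed V A T \<longleftrightarrow> (\<forall>x \<in> Obj V. \<exists>G. right_adjoint A A (act_by V T x) G)"


section \<open>Induced skew monoidal structures\<close>

definition pulled_tensor ::
  "('vo, 'va, 'o, 'a) action \<Rightarrow> ('o, 'a, 'vo, 'va) fctr \<Rightarrow> ('o \<times> 'o, 'a \<times> 'a, 'o, 'a) fctr" where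
  "pulled_tensor T K =
    \<lparr>OMap = (\<lambda>(a, b). OMap K a \<star>\<^bsub>T\<^esub> b), AMap = (\<lambda>(f, g). AMap K f \<bullet>\<^bsub>T\<^esub> g)\<rparr>"

text \<open>
  \<open>L\<close> is a left adjoint of \<open>J\<^sub>*\<close> with unit \<open>\<eta>\<close> and counit \<open>\<epsilon>\<close>; \<open>gamma_left\<close> is
  \<open>\<gamma>~\<^bsub>a,b\<^esub> : L (L a * b) \<rightarrow> L a \<otimes> L b\<close>.
\<close>

definition gamma_left where
  "gamma_left V S A T J L \<eta> \<epsilon> a b =
    transpose_left V L \<epsilon> (OMap L a \<otimes>\<^bsub>S\<^esub> OMap L b)
      (inv_arr A (Mult T (OMap L a) (OMap L b) J) \<cdot>\<^bsub>A\<^esub> (Id V (OMap L a) \<bullet>\<^bsub>T\<^esub> \<eta> b))"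

definition induced_left ::
  "('vo, 'va) cat \<Rightarrow> ('vo, 'va) skew \<Rightarrow> ('o, 'a) cat \<Rightarrow> ('vo, 'va, 'o, 'a) action \<Rightarrow> 'o \<Rightarrow>
   ('o, 'a, 'vo, 'va) fctr \<Rightarrow> ('o \<Rightarrow> 'a) \<Rightarrow> ('vo \<Rightarrow> 'va) \<Rightarrow> ('o, 'a) skew" where
  "induced_left V S A T J L \<eta> \<epsilon> =
    \<lparr>Tensor = pulled_tensor T L,
     Unit = J,
     Assoc = (\<lambda>a b c. Mult T (OMap L a) (OMap L b) c
                \<cdot>\<^bsub>A\<^esub> (gamma_left V S A T J L \<eta> \<epsilon> a b \<bullet>\<^bsub>T\<^esub> Id A c)),
     Lunit = (\<lambda>a. Unitor T a
                \<cdot>\<^bsub>A\<^esub> (\<epsilon> (Unit S) \<bullet>\<^bsub>T\<^esub> Id A a)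
                \<cdot>\<^bsub>A\<^esub> (AMap L (inv_arr A (Unitor T J)) \<bullet>\<^bsub>T\<^esub> Id A a)),
     Runit = \<eta>\<rparr>"

text \<open>
  \<open>R\<close> is a right adjoint of \<open>J\<^sub>*\<close> with unit \<open>\<eta>\<close> and counit \<open>\<epsilon>\<close>; \<open>gamma_right\<close> is
  \<open>\<gamma>~\<^bsub>a,b\<^esub> : R a \<otimes> R b \<rightarrow> R (R a * b)\<close>.
\<close>

definition gamma_right where
  "gamma_right V S A T J R \<eta> \<epsilon> a b =
    transpose_right V R \<eta> (OMap R a \<otimes>\<^bsub>S\<^esub> OMap R b)
      ((Id V (OMap R a) \<bullet>\<^bsub>T\<^esub> \<epsilon> b) \<cdot>\<^bsub>A\<^esub> Mult T (OMap R a) (OMap R b) J)"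

definition induced_right ::
  "('vo, 'va) cat \<Rightarrow> ('vo, 'va) skew \<Rightarrow> ('o, 'a) cat \<Rightarrow> ('vo, 'va, 'o, 'a) action \<Rightarrow> 'o \<Rightarrow>
   ('o, 'a, 'vo, 'va) fctr \<Rightarrow> ('vo \<Rightarrow> 'va) \<Rightarrow> ('o \<Rightarrow> 'a) \<Rightarrow> ('o, 'a) skew" where
  "induced_right V S A T J R \<eta> \<epsilon> =
    \<lparr>Tensor = pulled_tensor T R,
     Unit = J,
     Assoc = (\<lambda>a b c. (gamma_right V S A T J R \<eta> \<epsilon> a b \<bullet>\<^bsub>T\<^esub> Id A c)
                \<cdot>\<^bsub>A\<^esub> inv_arr A (Mult T (OMap R a) (OMap R b) c)),
     Lunit = (\<lambda>a. (AMap R (Unitor T J) \<bullet>\<^bsub>T\<^esub> Id A a)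
                \<cdot>\<^bsub>A\<^esub> (\<eta> (Unit S) \<bullet>\<^bsub>T\<^esub> Id A a)
                \<cdot>\<^bsub>A\<^esub> inv_arr A (Unitor T a)),
     Runit = \<epsilon>\<rparr>"

end

theory Submission
  imports Defs
begin

text \<open>
  Let \<open>L\<close> be left adjoint to \<open>J\<^sub>* = (-) * J\<close>, with unit \<open>\<eta>\<close>.  The induced structure comes from two
  comparison arrows of \<open>V\<close>, namely \<open>L (L a * b) \<rightarrow> L a \<otimes> L b\<close> and \<open>L J \<rightarrow> I\<close> (\<open>tensor_comparison\<close> and
  \<open>unit_comparison\<close>), which are what makes \<open>L\<close> an opmonoidal functor.  The associator and the left unitor
  at an object \<open>c\<close> are the coherence isomorphisms \<open>m\<close> and \<open>u\<close> of the action composed with these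
  arrows acting on \<open>c\<close>.

  Each of the three axioms that involve a free last variable \<open>c\<close> (the pentagon, the triangle and the
  compatibility of the left unitor with the associator) therefore reduces to an equation
  \<open>\<phi> c \<cdot> (p * c) = \<psi> c \<cdot> (q * c)\<close>, where \<open>p\<close> and \<open>q\<close> are arrows of \<open>V\<close> out of some \<open>L k\<close>, and
  \<open>\<phi>\<close>, \<open>\<psi>\<close> are families of isomorphisms built from \<open>m\<close> and \<open>u\<close>.  The action axioms say exactly that
  \<open>\<phi>\<close> and \<open>\<psi>\<close> differ by a structural arrow \<open>e\<close> of \<open>V\<close> (associator, left or right unitor) acting on \<open>c\<close>.
  Hence the equation is a consequence of \<open>e \<cdot> p = q\<close> if \<open>e\<close> goes from the target of \<open>p\<close> to that of
  \<open>q\<close>, and of \<open>e \<cdot> q = p\<close> in the opposite case; and since arrows out of \<open>L k\<close> are determined by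
  their transposes, that one follows from the given equation at the single object \<open>c = J\<close> precomposed with
  \<open>\<eta> k\<close> (\<open>linked_at_J\<close>).  There it is a short calculation, since \<open>\<eta>\<close> turns the comparison arrows back
  into the arrows of which they are transposes; for the tensor comparison this is the axiom relating the
  associator and the right unitor \<open>\<eta>\<close> (\<open>gamma_unit\<close>).

  The argument does not depend on the direction of \<open>e\<close>.  So it applies as well to the
  opposite categories of \<open>V\<close> and \<open>A\<close>, with \<open>m\<close> and \<open>u\<close> replaced by their inverses, although
  \<open>V\<close> with its arrows reversed is only right skew monoidal.  A right adjoint of \<open>J\<^sub>*\<close> becomes a left
  adjoint there, and a left skew monoidal structure on the opposite of \<open>A\<close> is a right skew monoidal
  structure on \<open>A\<close>, which settles the case of a right adjoint.

  Closedness is composition of adjunctions: \<open>(-) \<lhd> b\<close> is the adjoint of \<open>J\<^sub>*\<close> followed by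
  \<open>(-) * b\<close>, and \<open>a \<lhd> (-)\<close> is the action of a single object of \<open>V\<close>.
\<close>


section \<open>Typing of arrows by domain and codomain\<close>

text \<open>
  Typing judgements are turned into rewrite rules for membership, domain and codomain, so that
  simplification discharges the side conditions of composability.
\<close>

context category
begin

lemma hom_iff: "f \<in> hom C a b \<longleftrightarrow> f \<in> Arr C \<and> Dom C f = a \<and> Cod C f = b"
  by (auto simp: hom_def)

lemma Dom_Cod_Obj [simp]:
  "f \<in> Arr C \<Longrightarrow> Dom C f \<in> Obj C" "f \<in> Arr C \<Longrightarrow> Cod C f \<in> Obj C"
  by (auto intro: Dom_in Cod_in)

lemma Id_typing [simp]:
  assumes "a \<in> Obj C"
  shows "Id C a \<in> Arr C" "Dom C (Id C a) = a" "Cod C (Id C a) = a"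
  using Id_in[OF assms] by (auto simp: hom_iff)

lemma Comp_typing [simp]:
  assumes "f \<in> Arr C" "g \<in> Arr C" "Cod C f = Dom C g"
  shows "g \<cdot> f \<in> Arr C" "Dom C (g \<cdot> f) = Dom C f" "Cod C (g \<cdot> f) = Cod C g"
  using Comp_in[of f "Dom C f" "Cod C f" g "Cod C g"] assms by (auto simp: hom_iff)

lemma Comp_Id [simp]:
  "f \<in> Arr C \<Longrightarrow> Cod C f = b \<Longrightarrow> Id C b \<cdot> f = f"
  "f \<in> Arr C \<Longrightarrow> Dom C f = a \<Longrightarrow> f \<cdot> Id C a = f"
  using Id_left Id_right by (auto simp: hom_iff)

lemma assoc:
  assumes "f \<in> Arr C" "g \<in> Arr C" "h \<in> Arr C" "Cod C f = Dom C g" "Cod C g = Dom C h"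
  shows "(h \<cdot> g) \<cdot> f = h \<cdot> (g \<cdot> f)"
  using Comp_assoc[of f "Dom C f" "Cod C f" g "Cod C g" h "Cod C h"] assms by (auto simp: hom_iff)

text \<open>
  Composites are kept associated to the right; an equation between composites must then also be
  applied in front of a further arrow \<open>t\<close>.
\<close>

lemma extend:
  assumes "p \<cdot> q = r" "p \<in> Arr C" "q \<in> Arr C" "Cod C q = Dom C p" "t \<in> Arr C" "Cod C t = Dom C q"
  shows "p \<cdot> (q \<cdot> t) = r \<cdot> t"
  using assms assoc[of t q p] by auto

lemma inv_arr_eq:
  assumes "inverse_arrows C f g"
  shows "inv_arr C f = g"
proof -
  have "g' = g" if "inverse_arrows C f g'" for g'
  proof -
    have "g' = g' \<cdot> (f \<cdot> g)"
      using assms that by (auto simp: inverse_arrows_def hom_iff)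
    also have "\<dots> = (g' \<cdot> f) \<cdot> g"
      using assms that by (intro assoc[symmetric]) (auto simp: inverse_arrows_def hom_iff)
    also have "\<dots> = g"
      using assms that by (auto simp: inverse_arrows_def hom_iff)
    finally show ?thesis .
  qed
  then show ?thesis
    unfolding inv_arr_def using assms by blast
qed

lemma inv_arr:
  assumes "iso_arr C f"
  shows "inv_arr C f \<in> Arr C" "Dom C (inv_arr C f) = Cod C f" "Cod C (inv_arr C f) = Dom C f"
    "inv_arr C f \<cdot> f = Id C (Dom C f)" "f \<cdot> inv_arr C f = Id C (Cod C f)"
proof -
  obtain g where "inverse_arrows C f g" using assms by (auto simp: iso_arr_def)
  then show "inv_arr C f \<in> Arr C" "Dom C (inv_arr C f) = Cod C f" "Cod C (inv_arr C f) = Dom C f"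
    "inv_arr C f \<cdot> f = Id C (Dom C f)" "f \<cdot> inv_arr C f = Id C (Cod C f)"
    using inv_arr_eq[of f g] by (auto simp: inverse_arrows_def hom_iff)
qed

lemma iso_arrI:
  assumes "f \<in> Arr C" "g \<in> Arr C" "Dom C g = Cod C f" "Cod C g = Dom C f"
    and "g \<cdot> f = Id C (Dom C f)" "f \<cdot> g = Id C (Cod C f)"
  shows "iso_arr C f"
  using assms by (auto simp: iso_arr_def inverse_arrows_def hom_iff)

lemma iso_arr_Id: "a \<in> Obj C \<Longrightarrow> iso_arr C (Id C a)"
  by (rule iso_arrI[of _ "Id C a"]) simp_all

lemma iso_arr_comp:
  assumes "f \<in> Arr C" "g \<in> Arr C" "Cod C f = Dom C g" "iso_arr C f" "iso_arr C g"
  shows "iso_arr C (g \<cdot> f)"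
proof (rule iso_arrI)
  note iso = inv_arr[OF assms(4)] inv_arr[OF assms(5)]
  show "(inv_arr C f \<cdot> inv_arr C g) \<cdot> (g \<cdot> f) = Id C (Dom C (g \<cdot> f))"
    using assms iso extend[OF iso(9), of f] by (simp add: assoc)
  show "(g \<cdot> f) \<cdot> (inv_arr C f \<cdot> inv_arr C g) = Id C (Cod C (g \<cdot> f))"
    using assms iso extend[OF iso(5), of "inv_arr C g"] by (simp add: assoc)
qed (use assms inv_arr[OF assms(4)] inv_arr[OF assms(5)] in simp_all)

lemma iso_arr_cancel:
  assumes "iso_arr C f" "f \<in> Arr C" "s \<in> Arr C" "t \<in> Arr C" "Cod C s = Dom C f" "Cod C t = Dom C f"
    and "f \<cdot> s = f \<cdot> t"
  shows "s = t"
proof -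
  note iso = inv_arr[OF assms(1)]
  have "s = inv_arr C f \<cdot> (f \<cdot> s)"
    using assms iso extend[OF iso(4), of s] by simp
  also have "\<dots> = t"
    using assms(2-6) iso extend[OF iso(4), of t] unfolding assms(7) by simp
  finally show ?thesis .
qed

text \<open>
  Used to pass a coherence equation \<open>f \<cdot> e = g\<close> to the opposite category, where the isomorphisms
  \<open>f\<close> and \<open>g\<close> are replaced by their inverses while \<open>e\<close> stays.
\<close>

lemma factor_inverse:
  assumes "f \<cdot> e = g" "f \<cdot> f' = Id C (Cod C f)" "g \<cdot> g' = Id C (Cod C g)" "iso_arr C f"
    and "f \<in> Arr C" "e \<in> Arr C" "f' \<in> Arr C" "g' \<in> Arr C"
    and "Cod C e = Dom C f" "Cod C f' = Dom C f" "Cod C g' = Dom C e"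
  shows "e \<cdot> g' = f'"
proof (rule iso_arr_cancel[OF assms(4)])
  show "f \<cdot> (e \<cdot> g') = f \<cdot> f'"
    using extend[OF assms(1), of g'] assms by auto
qed (use assms in simp_all)

end

context is_functor
begin

lemma OMap_Obj [simp]: "a \<in> Obj C \<Longrightarrow> OMap F a \<in> Obj D"
  by (rule OMap_in)

lemma AMap_typing [simp]:
  assumes "f \<in> Arr C"
  shows "AMap F f \<in> Arr D" "Dom D (AMap F f) = OMap F (Dom C f)" "Cod D (AMap F f) = OMap F (Cod C f)"
  using AMap_in[of f "Dom C f" "Cod C f"] assms by (auto simp: C.hom_iff D.hom_iff)

declare AMap_Id [simp]

lemma AMap_comp:
  "f \<in> Arr C \<Longrightarrow> g \<in> Arr C \<Longrightarrow> Cod C f = Dom C g \<Longrightarrow> AMap F (g \<cdot>\<^bsub>C\<^esub> f) = AMap F g \<cdot>\<^bsub>D\<^esub> AMap F f"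
  using AMap_Comp[of f "Dom C f" "Cod C f" g "Cod C g"] by (auto simp: C.hom_iff)

end

lemma is_functorI:
  assumes "category C" "category D"
    and "\<And>a. a \<in> Obj C \<Longrightarrow> OMap F a \<in> Obj D"
    and "\<And>f. f \<in> Arr C \<Longrightarrow> AMap F f \<in> hom D (OMap F (Dom C f)) (OMap F (Cod C f))"
    and "\<And>a. a \<in> Obj C \<Longrightarrow> AMap F (Id C a) = Id D (OMap F a)"
    and "\<And>f g. f \<in> Arr C \<Longrightarrow> g \<in> Arr C \<Longrightarrow> Cod C f = Dom C g \<Longrightarrow>
      AMap F (g \<cdot>\<^bsub>C\<^esub> f) = AMap F g \<cdot>\<^bsub>D\<^esub> AMap F f"
  shows "is_functor C D F"
  using assms unfolding is_functor_def is_functor_axioms_def by (auto simp: hom_def)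

lemma nat_transI:
  assumes "is_functor C D F" "is_functor C D G"
    and "\<And>a. a \<in> Obj C \<Longrightarrow> \<tau> a \<in> hom D (OMap F a) (OMap G a)"
    and "\<And>f. f \<in> Arr C \<Longrightarrow> \<tau> (Cod C f) \<cdot>\<^bsub>D\<^esub> AMap F f = AMap G f \<cdot>\<^bsub>D\<^esub> \<tau> (Dom C f)"
  shows "nat_trans C D F G \<tau>"
  using assms unfolding nat_trans_def nat_trans_axioms_def by (auto simp: hom_def)

context nat_trans
begin

lemma component_typing [simp]:
  assumes "a \<in> Obj C"
  shows "\<tau> a \<in> Arr D" "Dom D (\<tau> a) = OMap F a" "Cod D (\<tau> a) = OMap G a"
  using component_in[OF assms] by (auto simp: F.D.hom_iff)

lemma natural:
  "f \<in> Arr C \<Longrightarrow> \<tau> (Cod C f) \<cdot>\<^bsub>D\<^esub> AMap F f = AMap G f \<cdot>\<^bsub>D\<^esub> \<tau> (Dom C f)"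
  by (rule naturality) (auto simp: F.C.hom_iff)

end

lemma id_fctr_simps [simp]: "OMap id_fctr a = a" "AMap id_fctr f = f"
  by (auto simp: id_fctr_def)

lemma comp_fctr_simps [simp]:
  "OMap (G \<circ>\<^sub>F F) a = OMap G (OMap F a)" "AMap (G \<circ>\<^sub>F F) f = AMap G (AMap F f)"
  by (auto simp: comp_fctr_def)

lemma fix_simps [simp]:
  "OMap (fix_fst C F a) b = OMap F (a, b)" "AMap (fix_fst C F a) g = AMap F (Id C a, g)"
  "OMap (fix_snd D F b) a = OMap F (a, b)" "AMap (fix_snd D F b) f = AMap F (f, Id D b)"
  by (auto simp: fix_fst_def fix_snd_def)

lemma prod_cat_simps [simp]:
  "Obj (prod_cat C D) = Obj C \<times> Obj D" "Arr (prod_cat C D) = Arr C \<times> Arr D"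
  "Dom (prod_cat C D) (f, g) = (Dom C f, Dom D g)" "Cod (prod_cat C D) (f, g) = (Cod C f, Cod D g)"
  "Id (prod_cat C D) (a, b) = (Id C a, Id D b)"
  "(f', g') \<cdot>\<^bsub>prod_cat C D\<^esub> (f, g) = (f' \<cdot>\<^bsub>C\<^esub> f, g' \<cdot>\<^bsub>D\<^esub> g)"
  by (auto simp: prod_cat_def)

lemma category_prod_cat:
  assumes "category C" "category D"
  shows "category (prod_cat C D)"
proof -
  interpret C: category C by fact
  interpret D: category D by fact
  show ?thesis
    by unfold_locales (auto simp: hom_def C.assoc D.assoc)
qed

lemma is_functor_comp:
  assumes "is_functor C D F" "is_functor D E G"
  shows "is_functor C E (G \<circ>\<^sub>F F)"
proof -
  interpret F: is_functor C D F by fact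
  interpret G: is_functor D E G by fact
  show ?thesis
    by (rule is_functorI) (auto simp: F.AMap_comp G.AMap_comp F.C.category_axioms G.D.category_axioms G.D.hom_iff)
qed

lemma is_functor_id: "category C \<Longrightarrow> is_functor C C id_fctr"
  by (rule is_functorI) (auto simp: hom_def)

locale bifunctor = C: category C + D: category D + prod: is_functor "prod_cat C D" E F
  for C :: "('o1, 'a1) cat" and D :: "('o2, 'a2) cat" and E :: "('o3, 'a3) cat" and F
begin

lemma bi_typing [simp]:
  assumes "f \<in> Arr C" "g \<in> Arr D"
  shows "AMap F (f, g) \<in> Arr E" "Dom E (AMap F (f, g)) = OMap F (Dom C f, Dom D g)"
    "Cod E (AMap F (f, g)) = OMap F (Cod C f, Cod D g)"
  using prod.AMap_typing[of "(f, g)"] assms by auto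

lemma bi_Obj [simp]: "a \<in> Obj C \<Longrightarrow> b \<in> Obj D \<Longrightarrow> OMap F (a, b) \<in> Obj E"
  using prod.OMap_Obj[of "(a, b)"] by auto

lemma bi_Id [simp]: "a \<in> Obj C \<Longrightarrow> b \<in> Obj D \<Longrightarrow> AMap F (Id C a, Id D b) = Id E (OMap F (a, b))"
  using prod.AMap_Id[of "(a, b)"] by auto

lemma interchange:
  assumes "f \<in> Arr C" "f' \<in> Arr C" "Cod C f = Dom C f'" "g \<in> Arr D" "g' \<in> Arr D" "Cod D g = Dom D g'"
  shows "AMap F (f', g') \<cdot>\<^bsub>E\<^esub> AMap F (f, g) = AMap F (f' \<cdot>\<^bsub>C\<^esub> f, g' \<cdot>\<^bsub>D\<^esub> g)"
  using prod.AMap_comp[of "(f, g)" "(f', g')"] assms by auto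

lemma is_functor_fix_fst: "a \<in> Obj C \<Longrightarrow> is_functor D E (fix_fst C F a)"
  by (rule is_functorI)
    (auto simp: D.category_axioms prod.D.category_axioms interchange prod.D.hom_iff)

lemma is_functor_fix_snd: "b \<in> Obj D \<Longrightarrow> is_functor C E (fix_snd D F b)"
  by (rule is_functorI)
    (auto simp: C.category_axioms prod.D.category_axioms interchange prod.D.hom_iff)

end


section \<open>Composition of adjunctions\<close>

lemma adjunctionI:
  assumes "is_functor C D F" "is_functor D C G"
    and "\<And>a. a \<in> Obj C \<Longrightarrow> \<eta> a \<in> hom C a (OMap G (OMap F a))"
    and "\<And>f. f \<in> Arr C \<Longrightarrow> \<eta> (Cod C f) \<cdot>\<^bsub>C\<^esub> f = AMap G (AMap F f) \<cdot>\<^bsub>C\<^esub> \<eta> (Dom C f)"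
    and "\<And>x. x \<in> Obj D \<Longrightarrow> \<epsilon> x \<in> hom D (OMap F (OMap G x)) x"
    and "\<And>f. f \<in> Arr D \<Longrightarrow> \<epsilon> (Cod D f) \<cdot>\<^bsub>D\<^esub> AMap F (AMap G f) = f \<cdot>\<^bsub>D\<^esub> \<epsilon> (Dom D f)"
    and "\<And>a. a \<in> Obj C \<Longrightarrow> \<epsilon> (OMap F a) \<cdot>\<^bsub>D\<^esub> AMap F (\<eta> a) = Id D (OMap F a)"
    and "\<And>x. x \<in> Obj D \<Longrightarrow> AMap G (\<epsilon> x) \<cdot>\<^bsub>C\<^esub> \<eta> (OMap G x) = Id C (OMap G x)"
  shows "adjunction C D F G \<eta> \<epsilon>"
proof -
  interpret F: is_functor C D F by fact
  interpret G: is_functor D C G by fact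
  have "nat_trans C C id_fctr (G \<circ>\<^sub>F F) \<eta>"
    using assms by (intro nat_transI is_functor_id is_functor_comp[of C D F C G] F.C.category_axioms) auto
  moreover have "nat_trans D D (F \<circ>\<^sub>F G) id_fctr \<epsilon>"
    using assms by (intro nat_transI is_functor_id is_functor_comp[of D C G D F] F.D.category_axioms) auto
  ultimately show ?thesis
    using assms by (simp add: adjunction_def adjunction_axioms_def)
qed

context adjunction
begin

lemma unit_typing [simp]:
  "a \<in> Obj C \<Longrightarrow> \<eta> a \<in> Arr C" "a \<in> Obj C \<Longrightarrow> Dom C (\<eta> a) = a"
  "a \<in> Obj C \<Longrightarrow> Cod C (\<eta> a) = OMap G (OMap F a)"
  by simp_all

lemma counit_typing [simp]:
  "x \<in> Obj D \<Longrightarrow> \<epsilon> x \<in> Arr D" "x \<in> Obj D \<Longrightarrow> Dom D (\<epsilon> x) = OMap F (OMap G x)"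
  "x \<in> Obj D \<Longrightarrow> Cod D (\<epsilon> x) = x"
  by simp_all

lemma unit_natural:
  "f \<in> Arr C \<Longrightarrow> \<eta> (Cod C f) \<cdot>\<^bsub>C\<^esub> f = AMap G (AMap F f) \<cdot>\<^bsub>C\<^esub> \<eta> (Dom C f)"
  using unit.natural[of f] by simp

lemma counit_natural:
  "f \<in> Arr D \<Longrightarrow> \<epsilon> (Cod D f) \<cdot>\<^bsub>D\<^esub> AMap F (AMap G f) = f \<cdot>\<^bsub>D\<^esub> \<epsilon> (Dom D f)"
  using counit.natural[of f] by simp

end

lemma adjunction_comp:
  assumes "adjunction C D F G \<eta> \<epsilon>" "adjunction D E F' G' \<eta>' \<epsilon>'"
  shows "adjunction C E (F' \<circ>\<^sub>F F) (G \<circ>\<^sub>F G')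
    (\<lambda>a. AMap G (\<eta>' (OMap F a)) \<cdot>\<^bsub>C\<^esub> \<eta> a) (\<lambda>x. \<epsilon>' x \<cdot>\<^bsub>E\<^esub> AMap F' (\<epsilon> (OMap G' x)))"
proof -
  interpret A: adjunction C D F G \<eta> \<epsilon> by fact
  interpret B: adjunction D E F' G' \<eta>' \<epsilon>' by fact
  note [simp] = A.F.C.assoc A.F.D.assoc B.F.D.assoc
  show ?thesis
  proof (rule adjunctionI, goal_cases)
    case 1
    show ?case by (rule is_functor_comp A.F.is_functor_axioms B.F.is_functor_axioms)+
  next
    case 2
    show ?case by (rule is_functor_comp A.G.is_functor_axioms B.G.is_functor_axioms)+
  next
    case (3 a)
    then show ?case by (simp add: A.F.C.hom_iff)
  next
    case (4 f)
    have "AMap G (\<eta>' (Cod D (AMap F f)) \<cdot>\<^bsub>D\<^esub> AMap F f)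
        = AMap G (AMap G' (AMap F' (AMap F f)) \<cdot>\<^bsub>D\<^esub> \<eta>' (Dom D (AMap F f)))"
      using 4 by (subst B.unit_natural) simp_all
    then have "AMap G (\<eta>' (OMap F (Cod C f))) \<cdot>\<^bsub>C\<^esub> AMap G (AMap F f)
        = AMap G (AMap G' (AMap F' (AMap F f))) \<cdot>\<^bsub>C\<^esub> AMap G (\<eta>' (OMap F (Dom C f)))"
      using 4 by (simp add: A.G.AMap_comp)
    (* the composite unit is natural because \<eta>' is, under G, and \<eta> is *)
    from A.F.C.extend[OF this, of "\<eta> (Dom C f)"] 4 show ?case
      by (simp add: A.unit_natural)
  next
    case (5 x)
    then show ?case by (simp add: B.F.D.hom_iff)
  next
    case (6 f)
    have "AMap F' (\<epsilon> (Cod D (AMap G' f)) \<cdot>\<^bsub>D\<^esub> AMap F (AMap G (AMap G' f)))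
        = AMap F' (AMap G' f \<cdot>\<^bsub>D\<^esub> \<epsilon> (Dom D (AMap G' f)))"
      using 6 by (subst A.counit_natural) simp_all
    then have "AMap F' (\<epsilon> (OMap G' (Cod E f))) \<cdot>\<^bsub>E\<^esub> AMap F' (AMap F (AMap G (AMap G' f)))
        = AMap F' (AMap G' f) \<cdot>\<^bsub>E\<^esub> AMap F' (\<epsilon> (OMap G' (Dom E f)))"
      using 6 by (simp add: B.F.AMap_comp)
    moreover note B.F.D.extend[OF B.counit_natural[of f], of "AMap F' (\<epsilon> (OMap G' (Dom E f)))"]
    ultimately show ?case
      using 6 by simp
  next
    case (7 a)
    (* naturality of \<epsilon> at \<eta>' brings the two triangle identities together *)
    have "AMap F' (\<epsilon> (Cod D (\<eta>' (OMap F a))) \<cdot>\<^bsub>D\<^esub> AMap F (AMap G (\<eta>' (OMap F a))))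
        = AMap F' (\<eta>' (OMap F a) \<cdot>\<^bsub>D\<^esub> \<epsilon> (OMap F a))"
      using 7 by (subst A.counit_natural) simp_all
    then have "AMap F' (\<epsilon> (OMap G' (OMap F' (OMap F a)))) \<cdot>\<^bsub>E\<^esub> AMap F' (AMap F (AMap G (\<eta>' (OMap F a))))
        = AMap F' (\<eta>' (OMap F a)) \<cdot>\<^bsub>E\<^esub> AMap F' (\<epsilon> (OMap F a))"
      using 7 by (simp add: B.F.AMap_comp)
    from B.F.D.extend[OF this, of "AMap F' (AMap F (\<eta> a))"]
    have "AMap F' (\<epsilon> (OMap G' (OMap F' (OMap F a)))) \<cdot>\<^bsub>E\<^esub> AMap F' (AMap F (AMap G (\<eta>' (OMap F a)))) \<cdot>\<^bsub>E\<^esub> AMap F' (AMap F (\<eta> a))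
       = AMap F' (\<eta>' (OMap F a)) \<cdot>\<^bsub>E\<^esub> AMap F' (\<epsilon> (OMap F a) \<cdot>\<^bsub>D\<^esub> AMap F (\<eta> a))"
      using 7 by (simp add: B.F.AMap_comp)
    then show ?case
      using 7 B.triangle_left[of "OMap F a"] by (simp add: B.F.AMap_comp A.F.AMap_comp A.triangle_left)
  next
    case (8 x)
    (* naturality of \<eta>' at \<epsilon> brings the two triangle identities together *)
    have "AMap G (AMap G' (AMap F' (\<epsilon> (OMap G' x))) \<cdot>\<^bsub>D\<^esub> \<eta>' (Dom D (\<epsilon> (OMap G' x))))
        = AMap G (\<eta>' (OMap G' x) \<cdot>\<^bsub>D\<^esub> \<epsilon> (OMap G' x))"
      using 8 by (subst B.unit_natural[symmetric]) simp_all
    then have "AMap G (AMap G' (AMap F' (\<epsilon> (OMap G' x)))) \<cdot>\<^bsub>C\<^esub> AMap G (\<eta>' (OMap F (OMap G (OMap G' x))))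
        = AMap G (\<eta>' (OMap G' x)) \<cdot>\<^bsub>C\<^esub> AMap G (\<epsilon> (OMap G' x))"
      using 8 by (simp add: A.G.AMap_comp)
    from A.F.C.extend[OF this, of "\<eta> (OMap G (OMap G' x))"]
    have "AMap G (AMap G' (AMap F' (\<epsilon> (OMap G' x)))) \<cdot>\<^bsub>C\<^esub> AMap G (\<eta>' (OMap F (OMap G (OMap G' x)))) \<cdot>\<^bsub>C\<^esub> \<eta> (OMap G (OMap G' x))
        = AMap G (\<eta>' (OMap G' x))"
      using 8 by (simp add: A.triangle_right)
    moreover have "AMap G (AMap G' (\<epsilon>' x)) \<cdot>\<^bsub>C\<^esub> AMap G (\<eta>' (OMap G' x)) = Id C (OMap G (OMap G' x))"
      using 8 by (simp add: A.G.AMap_comp[symmetric] B.triangle_right)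
    ultimately show ?case
      using 8 by (simp add: B.G.AMap_comp A.G.AMap_comp)
  qed
qed

lemma right_adjoint_comp:
  "right_adjoint C D F G \<Longrightarrow> right_adjoint D E F' G' \<Longrightarrow> right_adjoint C E (F' \<circ>\<^sub>F F) (G \<circ>\<^sub>F G')"
  unfolding right_adjoint_def using adjunction_comp by blast


section \<open>Opposite categories\<close>

text \<open>
  Only arrows are reversed.  A functor, in particular a tensor product or an action, is therefore its own
  opposite, and the order of its arguments does not change.
\<close>

definition op_cat :: "('o, 'a) cat \<Rightarrow> ('o, 'a) cat" where
  "op_cat C = \<lparr>Obj = Obj C, Arr = Arr C, Dom = Cod C, Cod = Dom C, Id = Id C, Comp = (\<lambda>g f. f \<cdot>\<^bsub>C\<^esub> g)\<rparr>"

lemma op_cat_simps [simp]: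
  "Obj (op_cat C) = Obj C" "Arr (op_cat C) = Arr C" "Dom (op_cat C) = Cod C" "Cod (op_cat C) = Dom C"
  "Id (op_cat C) = Id C" "g \<cdot>\<^bsub>op_cat C\<^esub> f = f \<cdot>\<^bsub>C\<^esub> g"
  by (auto simp: op_cat_def)

lemma op_op_cat [simp]: "op_cat (op_cat C) = C"
  by (simp add: op_cat_def)

lemma hom_op_cat [simp]: "hom (op_cat C) a b = hom C b a"
  by (auto simp: hom_def)

lemma prod_op_cat: "prod_cat (op_cat C) (op_cat D) = op_cat (prod_cat C D)"
  by (auto simp: prod_cat_def op_cat_def fun_eq_iff)

lemma fix_op_cat [simp]: "fix_fst (op_cat C) F a = fix_fst C F a" "fix_snd (op_cat D) F b = fix_snd D F b"
  by (simp_all add: fix_fst_def fix_snd_def)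

lemma category_op:
  assumes "category C" shows "category (op_cat C)"
proof -
  interpret category C by fact
  show ?thesis
    by unfold_locales (auto simp: hom_iff assoc)
qed

lemma is_functor_op:
  assumes "is_functor C D F" shows "is_functor (op_cat C) (op_cat D) F"
proof -
  interpret is_functor C D F by fact
  show ?thesis
    by (rule is_functorI)
      (auto simp: D.hom_iff AMap_comp category_op C.category_axioms D.category_axioms)
qed

lemma nat_trans_op:
  assumes "nat_trans C D F G \<tau>" shows "nat_trans (op_cat C) (op_cat D) G F \<tau>"
proof -
  interpret nat_trans C D F G \<tau> by fact
  show ?thesis
    by (rule nat_transI)
      (auto simp: F.D.hom_iff natural is_functor_op F.is_functor_axioms G.is_functor_axioms)
qed

lemma adjunction_op:
  assumes "adjunction C D F G \<eta> \<epsilon>" shows "adjunction (op_cat D) (op_cat C) G F \<epsilon> \<eta>"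
proof -
  interpret adjunction C D F G \<eta> \<epsilon> by fact
  show ?thesis
    by (rule adjunctionI)
      (auto simp: F.C.hom_iff F.D.hom_iff unit_natural counit_natural triangle_left triangle_right
        is_functor_op F.is_functor_axioms G.is_functor_axioms)
qed

text \<open>
  Reversing the arrows exchanges the two sets of axioms one by one; up to the bracketing of triple
  composites nothing else changes.
\<close>

lemma right_skew_monoidal_op:
  assumes "left_skew_monoidal (op_cat C) S"
  shows "right_skew_monoidal C S"
proof -
  interpret L: left_skew_monoidal "op_cat C" S by fact
  have cat: "category C" using category_op[OF L.category_axioms] by simp
  interpret category C by (rule cat)
  have ten: "is_functor (prod_cat C C) C (Tensor S)"
    using is_functor_op[OF L.tensor.is_functor_axioms] by (simp add: prod_op_cat)
  interpret T: bifunctor C C C "Tensor S"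
    by (intro bifunctor.intro cat ten)
  have as: "Assoc S x y z \<in> Arr C" "Dom C (Assoc S x y z) = x \<otimes>\<^bsub>S\<^esub> (y \<otimes>\<^bsub>S\<^esub> z)"
    "Cod C (Assoc S x y z) = (x \<otimes>\<^bsub>S\<^esub> y) \<otimes>\<^bsub>S\<^esub> z" if "x \<in> Obj C" "y \<in> Obj C" "z \<in> Obj C" for x y z
    using L.Assoc_in[of x y z] that by (auto simp: hom_iff)
  show ?thesis
  proof (intro right_skew_monoidal.intro skew_data.intro right_skew_monoidal_axioms.intro
      skew_data_axioms.intro cat ten, goal_cases)
    case 1 then show ?case using L.Unit_in by simp
  next
    case 2 then show ?case using L.Assoc_in by simp
  next
    case 3 then show ?case using L.Assoc_natural by simp
  next
    case 4 then show ?case using nat_trans_op[OF L.Lunit_natural] by simp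
  next
    case 5 then show ?case using nat_trans_op[OF L.Runit_natural] by simp
  next
    case (6 w x y z) then show ?case using L.pentagon[of w x y z] by (simp add: assoc as)
  next
    case (7 x y) then show ?case using L.Assoc_Runit by simp
  next
    case (8 x y) then show ?case using L.Lunit_Assoc by simp
  next
    case 9 then show ?case using L.Lunit_Runit by simp
  next
    case (10 x y)
    have "Lunit S y \<in> Arr C" "Dom C (Lunit S y) = y" "Cod C (Lunit S y) = Unit S \<otimes>\<^bsub>S\<^esub> y"
      "Runit S x \<in> Arr C" "Dom C (Runit S x) = x \<otimes>\<^bsub>S\<^esub> Unit S" "Cod C (Runit S x) = x"
      using nat_trans.component_in[OF L.Lunit_natural, of y] nat_trans.component_in[OF L.Runit_natural, of x] 10
      by (auto simp: hom_iff)
    then show ?case using L.triangle[of x y] L.Unit_in 10 by (simp add: assoc as)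
  qed
qed


section \<open>Strong actions and the adjunction with the orbit functor of an object\<close>

text \<open>
  A strong action in which the inverses \<open>mi\<close>, \<open>ui\<close> of the coherence isomorphisms are explicit data and
  the associator and unitors of \<open>V\<close> do not occur.  These data are self-dual: passing to
  opposite categories exchanges \<open>m\<close> with \<open>mi\<close> and \<open>u\<close> with \<open>ui\<close>.
\<close>

locale tensor_action =
  V: category V + A: category A + tens: bifunctor V V V P + act: bifunctor V A A F
  for V :: "('vo, 'va) cat" and A :: "('o, 'a) cat" and P F +
  fixes I :: 'vo and m mi :: "'vo \<Rightarrow> 'vo \<Rightarrow> 'o \<Rightarrow> 'a" and u ui :: "'o \<Rightarrow> 'a"
  assumes I_Obj [simp]: "I \<in> Obj V"
    and m_hom: "\<lbrakk>x \<in> Obj V; y \<in> Obj V; a \<in> Obj A\<rbrakk> \<Longrightarrow>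
      m x y a \<in> hom A (OMap F (OMap P (x, y), a)) (OMap F (x, OMap F (y, a)))"
    and mi_hom: "\<lbrakk>x \<in> Obj V; y \<in> Obj V; a \<in> Obj A\<rbrakk> \<Longrightarrow>
      mi x y a \<in> hom A (OMap F (x, OMap F (y, a))) (OMap F (OMap P (x, y), a))"
    and m_mi: "\<lbrakk>x \<in> Obj V; y \<in> Obj V; a \<in> Obj A\<rbrakk> \<Longrightarrow>
      m x y a \<cdot>\<^bsub>A\<^esub> mi x y a = Id A (OMap F (x, OMap F (y, a)))"
    and mi_m: "\<lbrakk>x \<in> Obj V; y \<in> Obj V; a \<in> Obj A\<rbrakk> \<Longrightarrow>
      mi x y a \<cdot>\<^bsub>A\<^esub> m x y a = Id A (OMap F (OMap P (x, y), a))"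
    and m_natural: "\<lbrakk>f \<in> Arr V; g \<in> Arr V; h \<in> Arr A\<rbrakk> \<Longrightarrow>
      m (Cod V f) (Cod V g) (Cod A h) \<cdot>\<^bsub>A\<^esub> AMap F (AMap P (f, g), h) =
      AMap F (f, AMap F (g, h)) \<cdot>\<^bsub>A\<^esub> m (Dom V f) (Dom V g) (Dom A h)"
    and u_hom: "a \<in> Obj A \<Longrightarrow> u a \<in> hom A (OMap F (I, a)) a"
    and ui_hom: "a \<in> Obj A \<Longrightarrow> ui a \<in> hom A a (OMap F (I, a))"
    and u_ui: "a \<in> Obj A \<Longrightarrow> u a \<cdot>\<^bsub>A\<^esub> ui a = Id A a"
    and ui_u: "a \<in> Obj A \<Longrightarrow> ui a \<cdot>\<^bsub>A\<^esub> u a = Id A (OMap F (I, a))"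
    and u_natural: "h \<in> Arr A \<Longrightarrow> u (Cod A h) \<cdot>\<^bsub>A\<^esub> AMap F (Id V I, h) = h \<cdot>\<^bsub>A\<^esub> u (Dom A h)"
begin

abbreviation tensor_o (infixr "\<otimes>\<^sub>V" 70) where "x \<otimes>\<^sub>V y \<equiv> OMap P (x, y)"
abbreviation tensor_a (infixr "\<boxtimes>\<^sub>V" 70) where "f \<boxtimes>\<^sub>V g \<equiv> AMap P (f, g)"
abbreviation act_o (infixr "\<star>\<^sub>A" 70) where "x \<star>\<^sub>A a \<equiv> OMap F (x, a)"
abbreviation whisker_right (infixr "\<ltimes>" 70) where "p \<ltimes> a \<equiv> AMap F (p, Id A a)"
abbreviation whisker_left (infixr "\<rtimes>" 70) where "x \<rtimes> g \<equiv> AMap F (Id V x, g)"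
abbreviation comp_V (infixr "\<circ>\<^sub>V" 55) where "q \<circ>\<^sub>V p \<equiv> q \<cdot>\<^bsub>V\<^esub> p"
abbreviation comp_A (infixr "\<circ>\<^sub>A" 55) where "h \<circ>\<^sub>A g \<equiv> h \<cdot>\<^bsub>A\<^esub> g"

text \<open>
  The families \<open>\<phi>\<close> and \<open>\<psi>\<close>, starting at \<open>x * c\<close> and \<open>y * c\<close>, differ by an arrow between \<open>x\<close> and \<open>y\<close>.
  Both directions are admitted because a structural arrow of \<open>V\<close> changes direction in the opposite
  category.
\<close>

definition linked :: "'vo \<Rightarrow> 'vo \<Rightarrow> ('o \<Rightarrow> 'a) \<Rightarrow> ('o \<Rightarrow> 'a) \<Rightarrow> bool" where
  "linked x y \<phi> \<psi> \<longleftrightarrow>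
    (\<exists>e \<in> hom V x y. \<forall>c \<in> Obj A. \<psi> c \<circ>\<^sub>A (e \<ltimes> c) = \<phi> c) \<or>
    (\<exists>e \<in> hom V y x. \<forall>c \<in> Obj A. \<phi> c \<circ>\<^sub>A (e \<ltimes> c) = \<psi> c)"

lemma m_typing [simp]:
  assumes "x \<in> Obj V" "y \<in> Obj V" "a \<in> Obj A"
  shows "m x y a \<in> Arr A" "Dom A (m x y a) = (x \<otimes>\<^sub>V y) \<star>\<^sub>A a" "Cod A (m x y a) = x \<star>\<^sub>A (y \<star>\<^sub>A a)"
    "mi x y a \<in> Arr A" "Dom A (mi x y a) = x \<star>\<^sub>A (y \<star>\<^sub>A a)" "Cod A (mi x y a) = (x \<otimes>\<^sub>V y) \<star>\<^sub>A a"
  using m_hom[OF assms] mi_hom[OF assms] by (auto simp: A.hom_iff)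

lemma u_typing [simp]:
  assumes "a \<in> Obj A"
  shows "u a \<in> Arr A" "Dom A (u a) = I \<star>\<^sub>A a" "Cod A (u a) = a"
    "ui a \<in> Arr A" "Dom A (ui a) = a" "Cod A (ui a) = I \<star>\<^sub>A a"
  using u_hom[OF assms] ui_hom[OF assms] by (auto simp: A.hom_iff)

lemma whisker_right_comp:
  assumes "p \<in> Arr V" "q \<in> Arr V" "Cod V p = Dom V q" "a \<in> Obj A"
  shows "(q \<circ>\<^sub>V p) \<ltimes> a = (q \<ltimes> a) \<circ>\<^sub>A (p \<ltimes> a)"
  using assms by (simp add: act.interchange)

lemma whisker_left_comp:
  assumes "g \<in> Arr A" "h \<in> Arr A" "Cod A g = Dom A h" "x \<in> Obj V"
  shows "x \<rtimes> (h \<circ>\<^sub>A g) = (x \<rtimes> h) \<circ>\<^sub>A (x \<rtimes> g)"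
  using assms by (simp add: act.interchange)

text \<open>
  As rewrite rules, this one moves arrows of \<open>V\<close> to the right of arrows of \<open>A\<close>, and the three rules for
  \<open>m\<close> below move \<open>m\<close> to the right of both.  Each is stated a second time in front of an arrow \<open>t\<close>, for
  use inside longer composites.
\<close>

lemma whisker_exchange:
  assumes "p \<in> Arr V" "g \<in> Arr A" "x = Dom V p" "b = Cod A g"
  shows "(p \<ltimes> b) \<circ>\<^sub>A (x \<rtimes> g) = (Cod V p \<rtimes> g) \<circ>\<^sub>A (p \<ltimes> Dom A g)"
    and "t \<in> Arr A \<Longrightarrow> Cod A t = x \<star>\<^sub>A Dom A g \<Longrightarrow>
      (p \<ltimes> b) \<circ>\<^sub>A (x \<rtimes> g) \<circ>\<^sub>A t = (Cod V p \<rtimes> g) \<circ>\<^sub>A (p \<ltimes> Dom A g) \<circ>\<^sub>A t"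
proof -
  show *: "(p \<ltimes> b) \<circ>\<^sub>A (x \<rtimes> g) = (Cod V p \<rtimes> g) \<circ>\<^sub>A (p \<ltimes> Dom A g)"
    using assms by (simp add: act.interchange)
  show "(p \<ltimes> b) \<circ>\<^sub>A (x \<rtimes> g) \<circ>\<^sub>A t = (Cod V p \<rtimes> g) \<circ>\<^sub>A (p \<ltimes> Dom A g) \<circ>\<^sub>A t"
    if "t \<in> Arr A" "Cod A t = x \<star>\<^sub>A Dom A g"
    using A.extend[OF *, of t] assms that by (simp add: A.assoc)
qed

lemma m_cancel:
  assumes "x \<in> Obj V" "y \<in> Obj V" "a \<in> Obj A" "t \<in> Arr A"
  shows "Cod A t = x \<star>\<^sub>A (y \<star>\<^sub>A a) \<Longrightarrow> m x y a \<circ>\<^sub>A mi x y a \<circ>\<^sub>A t = t"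
    and "Cod A t = (x \<otimes>\<^sub>V y) \<star>\<^sub>A a \<Longrightarrow> mi x y a \<circ>\<^sub>A m x y a \<circ>\<^sub>A t = t"
  using A.extend[OF m_mi, of x y a t] A.extend[OF mi_m, of x y a t] assms by simp_all

lemma u_cancel:
  assumes "a \<in> Obj A" "t \<in> Arr A"
  shows "Cod A t = a \<Longrightarrow> u a \<circ>\<^sub>A ui a \<circ>\<^sub>A t = t" "Cod A t = I \<star>\<^sub>A a \<Longrightarrow> ui a \<circ>\<^sub>A u a \<circ>\<^sub>A t = t"
  using A.extend[OF u_ui, of a t] A.extend[OF ui_u, of a t] assms by simp_all

lemma iso_m: "\<lbrakk>x \<in> Obj V; y \<in> Obj V; a \<in> Obj A\<rbrakk> \<Longrightarrow> iso_arr A (m x y a)"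
  by (rule A.iso_arrI[of _ "mi x y a"]) (simp_all add: m_mi mi_m)

lemma iso_u: "a \<in> Obj A \<Longrightarrow> iso_arr A (u a)"
  by (rule A.iso_arrI[of _ "ui a"]) (simp_all add: u_ui ui_u)

lemma iso_whisker_left:
  assumes "x \<in> Obj V" "g \<in> Arr A" "iso_arr A g"
  shows "iso_arr A (x \<rtimes> g)"
proof (rule A.iso_arrI)
  note iso = A.inv_arr[OF assms(3)]
  show "(x \<rtimes> inv_arr A g) \<circ>\<^sub>A (x \<rtimes> g) = Id A (Dom A (x \<rtimes> g))"
    using assms iso by (simp add: act.interchange)
  show "(x \<rtimes> g) \<circ>\<^sub>A (x \<rtimes> inv_arr A g) = Id A (Cod A (x \<rtimes> g))"
    using assms iso by (simp add: act.interchange)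
qed (use assms A.inv_arr[OF assms(3)] in simp_all)

lemma m_whisker_left:
  assumes "x \<in> Obj V" "y \<in> Obj V" "g \<in> Arr A" "b = Cod A g"
  shows "m x y b \<circ>\<^sub>A ((x \<otimes>\<^sub>V y) \<rtimes> g) = (x \<rtimes> (y \<rtimes> g)) \<circ>\<^sub>A m x y (Dom A g)"
    and "t \<in> Arr A \<Longrightarrow> Cod A t = (x \<otimes>\<^sub>V y) \<star>\<^sub>A Dom A g \<Longrightarrow>
      m x y b \<circ>\<^sub>A ((x \<otimes>\<^sub>V y) \<rtimes> g) \<circ>\<^sub>A t = (x \<rtimes> (y \<rtimes> g)) \<circ>\<^sub>A m x y (Dom A g) \<circ>\<^sub>A t"
proof -
  show *: "m x y b \<circ>\<^sub>A ((x \<otimes>\<^sub>V y) \<rtimes> g) = (x \<rtimes> (y \<rtimes> g)) \<circ>\<^sub>A m x y (Dom A g)"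
    using m_natural[of "Id V x" "Id V y" g] assms by simp
  show "m x y b \<circ>\<^sub>A ((x \<otimes>\<^sub>V y) \<rtimes> g) \<circ>\<^sub>A t = (x \<rtimes> (y \<rtimes> g)) \<circ>\<^sub>A m x y (Dom A g) \<circ>\<^sub>A t"
    if "t \<in> Arr A" "Cod A t = (x \<otimes>\<^sub>V y) \<star>\<^sub>A Dom A g"
    using A.extend[OF *, of t] assms that by (simp add: A.assoc)
qed

lemma m_whisker_first:
  assumes "p \<in> Arr V" "y \<in> Obj V" "c \<in> Obj A" "x = Cod V p"
  shows "m x y c \<circ>\<^sub>A ((p \<boxtimes>\<^sub>V Id V y) \<ltimes> c) = (p \<ltimes> (y \<star>\<^sub>A c)) \<circ>\<^sub>A m (Dom V p) y c"
    and "t \<in> Arr A \<Longrightarrow> Cod A t = (Dom V p \<otimes>\<^sub>V y) \<star>\<^sub>A c \<Longrightarrow>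
      m x y c \<circ>\<^sub>A ((p \<boxtimes>\<^sub>V Id V y) \<ltimes> c) \<circ>\<^sub>A t = (p \<ltimes> (y \<star>\<^sub>A c)) \<circ>\<^sub>A m (Dom V p) y c \<circ>\<^sub>A t"
proof -
  show *: "m x y c \<circ>\<^sub>A ((p \<boxtimes>\<^sub>V Id V y) \<ltimes> c) = (p \<ltimes> (y \<star>\<^sub>A c)) \<circ>\<^sub>A m (Dom V p) y c"
    using m_natural[of p "Id V y" "Id A c"] assms by simp
  show "m x y c \<circ>\<^sub>A ((p \<boxtimes>\<^sub>V Id V y) \<ltimes> c) \<circ>\<^sub>A t = (p \<ltimes> (y \<star>\<^sub>A c)) \<circ>\<^sub>A m (Dom V p) y c \<circ>\<^sub>A t"
    if "t \<in> Arr A" "Cod A t = (Dom V p \<otimes>\<^sub>V y) \<star>\<^sub>A c"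
    using A.extend[OF *, of t] assms that by (simp add: A.assoc)
qed

lemma m_whisker_second:
  assumes "x \<in> Obj V" "q \<in> Arr V" "c \<in> Obj A" "y = Cod V q"
  shows "m x y c \<circ>\<^sub>A ((Id V x \<boxtimes>\<^sub>V q) \<ltimes> c) = (x \<rtimes> (q \<ltimes> c)) \<circ>\<^sub>A m x (Dom V q) c"
    and "t \<in> Arr A \<Longrightarrow> Cod A t = (x \<otimes>\<^sub>V Dom V q) \<star>\<^sub>A c \<Longrightarrow>
      m x y c \<circ>\<^sub>A ((Id V x \<boxtimes>\<^sub>V q) \<ltimes> c) \<circ>\<^sub>A t = (x \<rtimes> (q \<ltimes> c)) \<circ>\<^sub>A m x (Dom V q) c \<circ>\<^sub>A t"
proof -
  show *: "m x y c \<circ>\<^sub>A ((Id V x \<boxtimes>\<^sub>V q) \<ltimes> c) = (x \<rtimes> (q \<ltimes> c)) \<circ>\<^sub>A m x (Dom V q) c"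
    using m_natural[of "Id V x" q "Id A c"] assms by simp
  show "m x y c \<circ>\<^sub>A ((Id V x \<boxtimes>\<^sub>V q) \<ltimes> c) \<circ>\<^sub>A t = (x \<rtimes> (q \<ltimes> c)) \<circ>\<^sub>A m x (Dom V q) c \<circ>\<^sub>A t"
    if "t \<in> Arr A" "Cod A t = (x \<otimes>\<^sub>V Dom V q) \<star>\<^sub>A c"
    using A.extend[OF *, of t] assms that by (simp add: A.assoc)
qed

lemma mi_natural:
  assumes "f \<in> Arr V" "g \<in> Arr V" "h \<in> Arr A"
  shows "mi (Cod V f) (Cod V g) (Cod A h) \<circ>\<^sub>A AMap F (f, AMap F (g, h)) =
      AMap F (f \<boxtimes>\<^sub>V g, h) \<circ>\<^sub>A mi (Dom V f) (Dom V g) (Dom A h)"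
proof -
  let ?m = "m (Dom V f) (Dom V g) (Dom A h)" and ?mi = "mi (Dom V f) (Dom V g) (Dom A h)"
  let ?mi' = "mi (Cod V f) (Cod V g) (Cod A h)"
  have "?mi' \<circ>\<^sub>A AMap F (f, AMap F (g, h)) = ?mi' \<circ>\<^sub>A (AMap F (f, AMap F (g, h)) \<circ>\<^sub>A ?m) \<circ>\<^sub>A ?mi"
    using assms by (simp add: A.assoc m_mi)
  also have "\<dots> = AMap F (f \<boxtimes>\<^sub>V g, h) \<circ>\<^sub>A ?mi"
    using assms by (simp add: A.assoc m_cancel m_natural[symmetric])
  finally show ?thesis .
qed

lemma ui_natural:
  assumes "g \<in> Arr A"
  shows "ui (Cod A g) \<circ>\<^sub>A g = (I \<rtimes> g) \<circ>\<^sub>A ui (Dom A g)"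
proof -
  have "ui (Cod A g) \<circ>\<^sub>A g = ui (Cod A g) \<circ>\<^sub>A (g \<circ>\<^sub>A u (Dom A g)) \<circ>\<^sub>A ui (Dom A g)"
    using assms by (simp add: A.assoc u_ui)
  also have "\<dots> = (I \<rtimes> g) \<circ>\<^sub>A ui (Dom A g)"
    using assms by (simp add: A.assoc u_cancel u_natural[symmetric])
  finally show ?thesis .
qed

end

lemma tensor_action_op:
  assumes "tensor_action V A P F I m mi u ui"
  shows "tensor_action (op_cat V) (op_cat A) P F I mi m ui u"
proof -
  interpret tensor_action V A P F I m mi u ui by fact
  have "bifunctor (op_cat V) (op_cat V) (op_cat V) P" "bifunctor (op_cat V) (op_cat A) (op_cat A) F"
    by (auto simp: bifunctor_def prod_op_cat category_op is_functor_op V.category_axioms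
        A.category_axioms tens.prod.is_functor_axioms act.prod.is_functor_axioms)
  then show ?thesis
    by (auto simp: tensor_action_def tensor_action_axioms_def category_op V.category_axioms
        A.category_axioms m_hom mi_hom m_mi mi_m u_hom ui_hom u_ui ui_u mi_natural ui_natural)
qed

locale orbit_adjunction = tensor_action V A P F I m mi u ui +
  adj: adjunction A V L "fix_snd A F J" \<eta> \<epsilon>
  for V :: "('vo, 'va) cat" and A :: "('o, 'a) cat" and P F I m mi u ui J L \<eta> \<epsilon> +
  assumes J_Obj [simp]: "J \<in> Obj A"
begin

lemma unit_typing [simp]:
  assumes "a \<in> Obj A"
  shows "\<eta> a \<in> Arr A" "Dom A (\<eta> a) = a" "Cod A (\<eta> a) = OMap L a \<star>\<^sub>A J"
  using adj.unit_typing[OF assms] by simp_all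

lemma unit_natural:
  assumes "f \<in> Arr A" "a = Dom A f"
  shows "(AMap L f \<ltimes> J) \<circ>\<^sub>A \<eta> a = \<eta> (Cod A f) \<circ>\<^sub>A f"
    and "t \<in> Arr A \<Longrightarrow> Cod A t = Dom A f \<Longrightarrow> (AMap L f \<ltimes> J) \<circ>\<^sub>A \<eta> a \<circ>\<^sub>A t = \<eta> (Cod A f) \<circ>\<^sub>A f \<circ>\<^sub>A t"
proof -
  show *: "(AMap L f \<ltimes> J) \<circ>\<^sub>A \<eta> a = \<eta> (Cod A f) \<circ>\<^sub>A f"
    using adj.unit_natural[of f] assms by simp
  show "(AMap L f \<ltimes> J) \<circ>\<^sub>A \<eta> a \<circ>\<^sub>A t = \<eta> (Cod A f) \<circ>\<^sub>A f \<circ>\<^sub>A t" if "t \<in> Arr A" "Cod A t = Dom A f"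
    using A.extend[OF *, of t] assms that by (simp add: A.assoc)
qed

abbreviation transp where "transp x f \<equiv> transpose_left V L \<epsilon> x f"

lemma transp_typing:
  assumes "f \<in> Arr A" "Cod A f = x \<star>\<^sub>A J" "x \<in> Obj V"
  shows "transp x f \<in> Arr V" "Dom V (transp x f) = OMap L (Dom A f)" "Cod V (transp x f) = x"
  using assms by (simp_all add: transpose_left_def)

text \<open>
  The transpose of \<open>f\<close> is the solution of the universal property of \<open>\<eta>\<close>; the triangle identity at \<open>x\<close>
  cancels the counit.
\<close>

lemma transp_unit:
  assumes "f \<in> Arr A" "Cod A f = x \<star>\<^sub>A J" "x \<in> Obj V"
  shows "(transp x f \<ltimes> J) \<circ>\<^sub>A \<eta> (Dom A f) = f"
proof -
  have "(\<epsilon> x \<ltimes> J) \<circ>\<^sub>A \<eta> (x \<star>\<^sub>A J) \<circ>\<^sub>A f = f"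
    using A.extend[OF adj.triangle_right[of x, simplified], of f] assms by simp
  then show ?thesis
    using assms by (simp add: transpose_left_def whisker_right_comp A.assoc unit_natural)
qed

text \<open>
  Arrows out of \<open>L k\<close> are determined by their transposes: such an arrow \<open>r\<close> is recovered as the left
  transpose of \<open>(r * J) \<cdot> \<eta> k\<close>.
\<close>

lemma transpose_unique:
  assumes "p \<in> hom V (OMap L k) x" "q \<in> hom V (OMap L k) x" "k \<in> Obj A"
    and "(p \<ltimes> J) \<circ>\<^sub>A \<eta> k = (q \<ltimes> J) \<circ>\<^sub>A \<eta> k"
  shows "p = q"
proof -
  have *: "r = transp x ((r \<ltimes> J) \<circ>\<^sub>A \<eta> k)" if "r \<in> hom V (OMap L k) x" for r
  proof -
    have "transp x ((r \<ltimes> J) \<circ>\<^sub>A \<eta> k) = (\<epsilon> x \<circ>\<^sub>V AMap L (r \<ltimes> J)) \<circ>\<^sub>V AMap L (\<eta> k)"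
      using that \<open>k \<in> Obj A\<close> V.Dom_Cod_Obj[of r]
      by (auto simp: transpose_left_def adj.F.AMap_comp V.hom_iff V.assoc)
    also have "\<epsilon> x \<circ>\<^sub>V AMap L (r \<ltimes> J) = r \<circ>\<^sub>V \<epsilon> (OMap L k)"
      using adj.counit_natural[of r] that by (auto simp: V.hom_iff)
    also have "(r \<circ>\<^sub>V \<epsilon> (OMap L k)) \<circ>\<^sub>V AMap L (\<eta> k) = r"
      using that \<open>k \<in> Obj A\<close> by (auto simp: V.hom_iff V.assoc adj.triangle_left)
    finally show ?thesis by simp
  qed
  show ?thesis
    using *[OF assms(1)] *[OF assms(2)] assms(4) by simp
qed

text \<open>
  The reduction of the skew monoidal axioms to the object \<open>J\<close>.  If \<open>e : x \<rightarrow> y\<close> links the families, then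
  \<open>\<phi> J = \<psi> J \<cdot> (e * J)\<close>, and cancelling the isomorphism \<open>\<psi> J\<close> in the hypothesis shows that \<open>e \<cdot> p\<close> and
  \<open>q\<close> have the same transpose.  So \<open>e \<cdot> p = q\<close>, which gives the equation at every \<open>c\<close>.  A link in
  the other direction is treated with the two sides exchanged.
\<close>

lemma linked_at_J:
  assumes "linked x y \<phi> \<psi>" "x \<in> Obj V" "y \<in> Obj V" "k \<in> Obj A" "c \<in> Obj A"
    and \<phi>: "\<And>c. c \<in> Obj A \<Longrightarrow> \<phi> c \<in> Arr A \<and> Dom A (\<phi> c) = x \<star>\<^sub>A c"
    and \<psi>: "\<And>c. c \<in> Obj A \<Longrightarrow> \<psi> c \<in> Arr A \<and> Dom A (\<psi> c) = y \<star>\<^sub>A c"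
    and iso: "iso_arr A (\<phi> J)" "iso_arr A (\<psi> J)"
    and p: "p \<in> hom V (OMap L k) x" and q: "q \<in> hom V (OMap L k) y"
    and eq: "\<phi> J \<circ>\<^sub>A (p \<ltimes> J) \<circ>\<^sub>A \<eta> k = \<psi> J \<circ>\<^sub>A (q \<ltimes> J) \<circ>\<^sub>A \<eta> k"
  shows "\<phi> c \<circ>\<^sub>A (p \<ltimes> c) = \<psi> c \<circ>\<^sub>A (q \<ltimes> c)"
proof -
  have *: "\<phi> c \<circ>\<^sub>A (p \<ltimes> c) = \<psi> c \<circ>\<^sub>A (q \<ltimes> c)"
    if e: "e \<in> hom V x y" "\<And>c. c \<in> Obj A \<Longrightarrow> \<psi> c \<circ>\<^sub>A (e \<ltimes> c) = \<phi> c"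
      and "y \<in> Obj V"
      and \<psi>: "\<And>c. c \<in> Obj A \<Longrightarrow> \<psi> c \<in> Arr A \<and> Dom A (\<psi> c) = y \<star>\<^sub>A c" and iso: "iso_arr A (\<psi> J)"
      and p: "p \<in> hom V (OMap L k) x" and q: "q \<in> hom V (OMap L k) y"
      and eq: "\<phi> J \<circ>\<^sub>A (p \<ltimes> J) \<circ>\<^sub>A \<eta> k = \<psi> J \<circ>\<^sub>A (q \<ltimes> J) \<circ>\<^sub>A \<eta> k"
    for x y e \<phi> \<psi> p q
  proof -
    note [simp] = \<open>y \<in> Obj V\<close> \<open>k \<in> Obj A\<close> \<open>c \<in> Obj A\<close>
    have [simp]: "e \<in> Arr V" "Dom V e = x" "Cod V e = y" "p \<in> Arr V" "Dom V p = OMap L k" "Cod V p = x"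
        "q \<in> Arr V" "Dom V q = OMap L k" "Cod V q = y"
      using e(1) p q by (simp_all add: V.hom_iff)
    have [simp]: "x \<in> Obj V"
      using V.Dom_Cod_Obj(1)[of e] by simp
    have "\<psi> J \<circ>\<^sub>A ((e \<circ>\<^sub>V p) \<ltimes> J) \<circ>\<^sub>A \<eta> k = (\<psi> J \<circ>\<^sub>A (e \<ltimes> J)) \<circ>\<^sub>A (p \<ltimes> J) \<circ>\<^sub>A \<eta> k"
      using \<psi>[of J] by (simp add: whisker_right_comp A.assoc)
    also have "\<dots> = \<psi> J \<circ>\<^sub>A (q \<ltimes> J) \<circ>\<^sub>A \<eta> k"
      using e(2)[of J] eq by simp
    finally have "((e \<circ>\<^sub>V p) \<ltimes> J) \<circ>\<^sub>A \<eta> k = (q \<ltimes> J) \<circ>\<^sub>A \<eta> k"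
      by (rule A.iso_arr_cancel[OF iso, rotated -1]) (use \<psi>[of J] in simp_all)
    then have q_eq: "e \<circ>\<^sub>V p = q"
      by (rule transpose_unique[of _ k y, rotated -1]) (simp_all add: V.hom_iff)
    have "\<psi> c \<circ>\<^sub>A (q \<ltimes> c) = (\<psi> c \<circ>\<^sub>A (e \<ltimes> c)) \<circ>\<^sub>A (p \<ltimes> c)"
      unfolding q_eq[symmetric] using \<psi>[of c] by (simp add: whisker_right_comp A.assoc)
    then show ?thesis using e(2)[of c] by simp
  qed
  from assms(1) show ?thesis
    unfolding linked_def
  proof (elim disjE bexE)
    fix e assume "e \<in> hom V x y" "\<forall>c \<in> Obj A. \<psi> c \<circ>\<^sub>A (e \<ltimes> c) = \<phi> c"
    then show ?thesis
      using * [of e x y \<psi> \<phi> p q] assms by blast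
  next
    fix e assume "e \<in> hom V y x" "\<forall>c \<in> Obj A. \<phi> c \<circ>\<^sub>A (e \<ltimes> c) = \<psi> c"
    then show ?thesis
      using * [of e y x \<phi> \<psi> q p] assms by metis
  qed
qed

text \<open>
  The opmonoidal structure of \<open>L\<close>: comparison arrows \<open>L (L a * b) \<rightarrow> L a \<otimes> L b\<close> and \<open>L J \<rightarrow> I\<close>.
\<close>

definition tensor_comparison :: "'o \<Rightarrow> 'o \<Rightarrow> 'va" where
  "tensor_comparison a b = transp (OMap L a \<otimes>\<^sub>V OMap L b) (mi (OMap L a) (OMap L b) J \<circ>\<^sub>A (OMap L a \<rtimes> \<eta> b))"

definition unit_comparison :: 'va where
  "unit_comparison = transp I (ui J)"

lemma tensor_comparison_typing [simp]:
  assumes "a \<in> Obj A" "b \<in> Obj A"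
  shows "tensor_comparison a b \<in> Arr V" "Dom V (tensor_comparison a b) = OMap L (OMap L a \<star>\<^sub>A b)"
    "Cod V (tensor_comparison a b) = OMap L a \<otimes>\<^sub>V OMap L b"
  unfolding tensor_comparison_def using assms by (simp_all add: transp_typing)

lemma unit_comparison_typing [simp]:
  "unit_comparison \<in> Arr V" "Dom V unit_comparison = OMap L J" "Cod V unit_comparison = I"
  unfolding unit_comparison_def by (simp_all add: transp_typing)

lemma tensor_comparison_unit:
  assumes "a \<in> Obj A" "b \<in> Obj A"
  shows "(tensor_comparison a b \<ltimes> J) \<circ>\<^sub>A \<eta> (OMap L a \<star>\<^sub>A b) = mi (OMap L a) (OMap L b) J \<circ>\<^sub>A (OMap L a \<rtimes> \<eta> b)"
    and "t \<in> Arr A \<Longrightarrow> Cod A t = OMap L a \<star>\<^sub>A b \<Longrightarrow> (tensor_comparison a b \<ltimes> J) \<circ>\<^sub>A \<eta> (OMap L a \<star>\<^sub>A b) \<circ>\<^sub>A t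
      = mi (OMap L a) (OMap L b) J \<circ>\<^sub>A (OMap L a \<rtimes> \<eta> b) \<circ>\<^sub>A t"
proof -
  show *: "(tensor_comparison a b \<ltimes> J) \<circ>\<^sub>A \<eta> (OMap L a \<star>\<^sub>A b) = mi (OMap L a) (OMap L b) J \<circ>\<^sub>A (OMap L a \<rtimes> \<eta> b)"
    unfolding tensor_comparison_def
    using transp_unit[of "mi (OMap L a) (OMap L b) J \<circ>\<^sub>A (OMap L a \<rtimes> \<eta> b)" "OMap L a \<otimes>\<^sub>V OMap L b"] assms
    by simp
  show "(tensor_comparison a b \<ltimes> J) \<circ>\<^sub>A \<eta> (OMap L a \<star>\<^sub>A b) \<circ>\<^sub>A t
      = mi (OMap L a) (OMap L b) J \<circ>\<^sub>A (OMap L a \<rtimes> \<eta> b) \<circ>\<^sub>A t" if "t \<in> Arr A" "Cod A t = OMap L a \<star>\<^sub>A b"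
    using A.extend[OF *, of t] assms that by (simp add: A.assoc)
qed

lemma unit_comparison_unit: "(unit_comparison \<ltimes> J) \<circ>\<^sub>A \<eta> J = ui J"
  unfolding unit_comparison_def using transp_unit[of "ui J" I] by simp

definition gamma where
  "gamma a b c = m (OMap L a) (OMap L b) c \<circ>\<^sub>A (tensor_comparison a b \<ltimes> c)"

definition lambda where
  "lambda a = u a \<circ>\<^sub>A (unit_comparison \<ltimes> a)"

lemma gamma_typing [simp]:
  assumes "a \<in> Obj A" "b \<in> Obj A" "c \<in> Obj A"
  shows "gamma a b c \<in> Arr A" "Dom A (gamma a b c) = OMap L (OMap L a \<star>\<^sub>A b) \<star>\<^sub>A c"
    "Cod A (gamma a b c) = OMap L a \<star>\<^sub>A (OMap L b \<star>\<^sub>A c)"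
  using assms by (simp_all add: gamma_def)

lemma lambda_typing [simp]:
  assumes "a \<in> Obj A"
  shows "lambda a \<in> Arr A" "Dom A (lambda a) = OMap L J \<star>\<^sub>A a" "Cod A (lambda a) = a"
  using assms by (simp_all add: lambda_def)

text \<open>
  At \<open>c = J\<close> the unit \<open>\<eta>\<close> undoes the transposition in the tensor comparison, and \<open>m\<close> cancels its inverse.
\<close>

lemma gamma_unit:
  assumes "a \<in> Obj A" "b \<in> Obj A"
  shows "gamma a b J \<circ>\<^sub>A \<eta> (OMap L a \<star>\<^sub>A b) = OMap L a \<rtimes> \<eta> b"
  using assms by (simp add: gamma_def A.assoc tensor_comparison_unit m_cancel)

lemma tensor_comparison_natural:
  assumes "f \<in> Arr A" "g \<in> Arr A"
  shows "tensor_comparison (Cod A f) (Cod A g) \<circ>\<^sub>V AMap L (AMap F (AMap L f, g)) =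
    (AMap L f \<boxtimes>\<^sub>V AMap L g) \<circ>\<^sub>V tensor_comparison (Dom A f) (Dom A g)"
proof (rule transpose_unique)
  let ?k = "OMap L (Dom A f) \<star>\<^sub>A Dom A g"
  let ?a = "OMap L (Dom A f)" and ?a' = "OMap L (Cod A f)"
  have "((tensor_comparison (Cod A f) (Cod A g) \<circ>\<^sub>V AMap L (AMap F (AMap L f, g))) \<ltimes> J) \<circ>\<^sub>A \<eta> ?k =
    mi ?a' (OMap L (Cod A g)) J \<circ>\<^sub>A ((?a' \<rtimes> \<eta> (Cod A g)) \<circ>\<^sub>A AMap F (AMap L f, g))"
    using assms by (simp add: whisker_right_comp A.assoc unit_natural tensor_comparison_unit)
  also have "(?a' \<rtimes> \<eta> (Cod A g)) \<circ>\<^sub>A AMap F (AMap L f, g) = AMap F (AMap L f, AMap L g \<ltimes> J) \<circ>\<^sub>A (?a \<rtimes> \<eta> (Dom A g))"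
    using assms by (simp add: act.interchange unit_natural)
  also have "mi ?a' (OMap L (Cod A g)) J \<circ>\<^sub>A \<dots> =
     ((AMap L f \<boxtimes>\<^sub>V AMap L g) \<ltimes> J) \<circ>\<^sub>A mi ?a (OMap L (Dom A g)) J \<circ>\<^sub>A (?a \<rtimes> \<eta> (Dom A g))"
    using A.extend[OF mi_natural[of "AMap L f" "AMap L g" "Id A J"], of "?a \<rtimes> \<eta> (Dom A g)"] assms
    by (simp add: A.assoc)
  also have "\<dots> = (((AMap L f \<boxtimes>\<^sub>V AMap L g) \<circ>\<^sub>V tensor_comparison (Dom A f) (Dom A g)) \<ltimes> J) \<circ>\<^sub>A \<eta> ?k"
    using assms by (simp add: whisker_right_comp A.assoc tensor_comparison_unit)
  finally show "((tensor_comparison (Cod A f) (Cod A g) \<circ>\<^sub>V AMap L (AMap F (AMap L f, g))) \<ltimes> J) \<circ>\<^sub>A \<eta> ?k = \<dots>" .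
qed (use assms in \<open>simp_all add: V.hom_iff\<close>)

lemma gamma_natural:
  assumes "f \<in> Arr A" "g \<in> Arr A" "h \<in> Arr A"
  shows "gamma (Cod A f) (Cod A g) (Cod A h) \<circ>\<^sub>A AMap F (AMap L (AMap F (AMap L f, g)), h) =
    AMap F (AMap L f, AMap F (AMap L g, h)) \<circ>\<^sub>A gamma (Dom A f) (Dom A g) (Dom A h)"
proof -
  have "(tensor_comparison (Cod A f) (Cod A g) \<ltimes> Cod A h) \<circ>\<^sub>A AMap F (AMap L (AMap F (AMap L f, g)), h)
    = AMap F (AMap L f \<boxtimes>\<^sub>V AMap L g, h) \<circ>\<^sub>A (tensor_comparison (Dom A f) (Dom A g) \<ltimes> Dom A h)"
    using assms by (simp add: act.interchange tensor_comparison_natural)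
  then show ?thesis
    using assms A.extend[OF m_natural[of "AMap L f" "AMap L g" h], of "tensor_comparison (Dom A f) (Dom A g) \<ltimes> Dom A h"]
    by (simp add: gamma_def A.assoc)
qed

lemma lambda_natural:
  assumes "g \<in> Arr A"
  shows "lambda (Cod A g) \<circ>\<^sub>A (OMap L J \<rtimes> g) = g \<circ>\<^sub>A lambda (Dom A g)"
  using assms A.extend[OF u_natural[of g], of "unit_comparison \<ltimes> Dom A g"]
  by (simp add: lambda_def A.assoc whisker_exchange)

lemma lambda_unit: "lambda J \<circ>\<^sub>A \<eta> J = Id A J"
  by (simp add: lambda_def A.assoc unit_comparison_unit u_ui)

end


section \<open>The induced skew monoidal structure\<close>

text \<open>
  These three hypotheses are all that the construction needs to know about the associator and the unitors
  of \<open>V\<close>.  They hold for a left skew monoidal \<open>V\<close> and also for its opposite.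
\<close>

locale coherent_orbit_adjunction = orbit_adjunction V A P F I m mi u ui J L \<eta> \<epsilon>
  for V :: "('vo, 'va) cat" and A :: "('o, 'a) cat" and P F I m mi u ui J L \<eta> \<epsilon> +
  assumes assoc_linked: "\<lbrakk>w \<in> Obj V; x \<in> Obj V; y \<in> Obj V\<rbrakk> \<Longrightarrow>
      linked ((w \<otimes>\<^sub>V x) \<otimes>\<^sub>V y) (w \<otimes>\<^sub>V (x \<otimes>\<^sub>V y))
        (\<lambda>c. m w x (y \<star>\<^sub>A c) \<circ>\<^sub>A m (w \<otimes>\<^sub>V x) y c) (\<lambda>c. (w \<rtimes> m x y c) \<circ>\<^sub>A m w (x \<otimes>\<^sub>V y) c)"
    and lunit_linked: "x \<in> Obj V \<Longrightarrow>
      linked (I \<otimes>\<^sub>V x) x (\<lambda>c. u (x \<star>\<^sub>A c) \<circ>\<^sub>A m I x c) (\<lambda>c. Id A (x \<star>\<^sub>A c))"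
    and runit_linked: "x \<in> Obj V \<Longrightarrow>
      linked (x \<otimes>\<^sub>V I) x (\<lambda>c. (x \<rtimes> u c) \<circ>\<^sub>A m x I c) (\<lambda>c. Id A (x \<star>\<^sub>A c))"
begin

lemma assoc_at_J:
  assumes "w \<in> Obj V" "x \<in> Obj V" "y \<in> Obj V" "k \<in> Obj A" "c \<in> Obj A"
    and p: "p \<in> hom V (OMap L k) ((w \<otimes>\<^sub>V x) \<otimes>\<^sub>V y)" and q: "q \<in> hom V (OMap L k) (w \<otimes>\<^sub>V (x \<otimes>\<^sub>V y))"
    and "m w x (y \<star>\<^sub>A J) \<circ>\<^sub>A m (w \<otimes>\<^sub>V x) y J \<circ>\<^sub>A (p \<ltimes> J) \<circ>\<^sub>A \<eta> k =
      (w \<rtimes> m x y J) \<circ>\<^sub>A m w (x \<otimes>\<^sub>V y) J \<circ>\<^sub>A (q \<ltimes> J) \<circ>\<^sub>A \<eta> k"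
  shows "m w x (y \<star>\<^sub>A c) \<circ>\<^sub>A m (w \<otimes>\<^sub>V x) y c \<circ>\<^sub>A (p \<ltimes> c) =
      (w \<rtimes> m x y c) \<circ>\<^sub>A m w (x \<otimes>\<^sub>V y) c \<circ>\<^sub>A (q \<ltimes> c)"
proof -
  note [simp] = assms(1-5)
  have "(m w x (y \<star>\<^sub>A c) \<circ>\<^sub>A m (w \<otimes>\<^sub>V x) y c) \<circ>\<^sub>A (p \<ltimes> c) =
      ((w \<rtimes> m x y c) \<circ>\<^sub>A m w (x \<otimes>\<^sub>V y) c) \<circ>\<^sub>A (q \<ltimes> c)"
    by (rule linked_at_J[OF assoc_linked _ _ _ _ _ _ _ _ p q])
      (use assms p q in \<open>auto simp: A.iso_arr_comp iso_m iso_whisker_left V.hom_iff A.assoc\<close>)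
  then show ?thesis
    using p q by (simp add: V.hom_iff A.assoc)
qed

lemma lunit_at_J:
  assumes "x \<in> Obj V" "k \<in> Obj A" "c \<in> Obj A"
    and p: "p \<in> hom V (OMap L k) (I \<otimes>\<^sub>V x)" and q: "q \<in> hom V (OMap L k) x"
    and "u (x \<star>\<^sub>A J) \<circ>\<^sub>A m I x J \<circ>\<^sub>A (p \<ltimes> J) \<circ>\<^sub>A \<eta> k = (q \<ltimes> J) \<circ>\<^sub>A \<eta> k"
  shows "u (x \<star>\<^sub>A c) \<circ>\<^sub>A m I x c \<circ>\<^sub>A (p \<ltimes> c) = q \<ltimes> c"
proof -
  note [simp] = assms(1-3)
  have "(u (x \<star>\<^sub>A c) \<circ>\<^sub>A m I x c) \<circ>\<^sub>A (p \<ltimes> c) = Id A (x \<star>\<^sub>A c) \<circ>\<^sub>A (q \<ltimes> c)"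
    by (rule linked_at_J[OF lunit_linked _ _ _ _ _ _ _ _ p q])
      (use assms p q in \<open>auto simp: A.iso_arr_comp A.iso_arr_Id iso_m iso_u V.hom_iff A.assoc\<close>)
  then show ?thesis
    using p q by (simp add: V.hom_iff A.assoc)
qed

lemma runit_at_J:
  assumes "x \<in> Obj V" "k \<in> Obj A" "c \<in> Obj A"
    and p: "p \<in> hom V (OMap L k) (x \<otimes>\<^sub>V I)" and q: "q \<in> hom V (OMap L k) x"
    and "(x \<rtimes> u J) \<circ>\<^sub>A m x I J \<circ>\<^sub>A (p \<ltimes> J) \<circ>\<^sub>A \<eta> k = (q \<ltimes> J) \<circ>\<^sub>A \<eta> k"
  shows "(x \<rtimes> u c) \<circ>\<^sub>A m x I c \<circ>\<^sub>A (p \<ltimes> c) = q \<ltimes> c"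
proof -
  note [simp] = assms(1-3)
  have "((x \<rtimes> u c) \<circ>\<^sub>A m x I c) \<circ>\<^sub>A (p \<ltimes> c) = Id A (x \<star>\<^sub>A c) \<circ>\<^sub>A (q \<ltimes> c)"
    by (rule linked_at_J[OF runit_linked _ _ _ _ _ _ _ _ p q])
      (use assms p q in \<open>auto simp: A.iso_arr_comp A.iso_arr_Id iso_m iso_u iso_whisker_left V.hom_iff A.assoc\<close>)
  then show ?thesis
    using p q by (simp add: V.hom_iff A.assoc)
qed

text \<open>
  By naturality of \<open>m\<close> all comparison arrows can be collected on the right, where they form the arrows
  \<open>p\<close> and \<open>q\<close> of \<open>V\<close> acting on \<open>z\<close>.  At \<open>z = J\<close>, after \<open>\<eta>\<close>, both sides become
  \<open>(L w * (L x * \<eta> y)) \<cdot> gamma w x y\<close>.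
\<close>

lemma gamma_pentagon:
  assumes [simp]: "w \<in> Obj A" "x \<in> Obj A" "y \<in> Obj A" "z \<in> Obj A"
  shows "(OMap L w \<rtimes> gamma x y z) \<circ>\<^sub>A gamma w (OMap L x \<star>\<^sub>A y) z \<circ>\<^sub>A (AMap L (gamma w x y) \<ltimes> z) =
    gamma w x (OMap L y \<star>\<^sub>A z) \<circ>\<^sub>A gamma (OMap L w \<star>\<^sub>A x) y z"
proof -
  let ?W = "OMap L w" and ?X = "OMap L x" and ?Y = "OMap L y"
  let ?k = "OMap L (?W \<star>\<^sub>A x) \<star>\<^sub>A y"
  let ?p = "(tensor_comparison w x \<boxtimes>\<^sub>V Id V ?Y) \<circ>\<^sub>V tensor_comparison (?W \<star>\<^sub>A x) y"
  let ?q = "(Id V ?W \<boxtimes>\<^sub>V tensor_comparison x y) \<circ>\<^sub>V tensor_comparison w (?X \<star>\<^sub>A y) \<circ>\<^sub>V AMap L (gamma w x y)"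
  have "m ?W ?X (?Y \<star>\<^sub>A J) \<circ>\<^sub>A m (?W \<otimes>\<^sub>V ?X) ?Y J \<circ>\<^sub>A (?p \<ltimes> J) \<circ>\<^sub>A \<eta> ?k = (?W \<rtimes> (?X \<rtimes> \<eta> y)) \<circ>\<^sub>A gamma w x y"
    by (simp add: gamma_def whisker_right_comp A.assoc tensor_comparison_unit m_whisker_first m_cancel
        whisker_exchange m_whisker_left)
  moreover have "(?W \<rtimes> m ?X ?Y J) \<circ>\<^sub>A m ?W (?X \<otimes>\<^sub>V ?Y) J \<circ>\<^sub>A (?q \<ltimes> J) \<circ>\<^sub>A \<eta> ?k =
      (?W \<rtimes> m ?X ?Y J) \<circ>\<^sub>A (?W \<rtimes> (tensor_comparison x y \<ltimes> J)) \<circ>\<^sub>A (?W \<rtimes> \<eta> (?X \<star>\<^sub>A y)) \<circ>\<^sub>A gamma w x y"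
    by (simp add: whisker_right_comp A.assoc unit_natural tensor_comparison_unit m_whisker_second m_cancel)
  moreover have "\<dots> = (?W \<rtimes> (gamma x y J \<circ>\<^sub>A \<eta> (?X \<star>\<^sub>A y))) \<circ>\<^sub>A gamma w x y"
    by (simp add: gamma_def[of x y J] whisker_left_comp A.assoc)
  ultimately have "m ?W ?X (?Y \<star>\<^sub>A z) \<circ>\<^sub>A m (?W \<otimes>\<^sub>V ?X) ?Y z \<circ>\<^sub>A (?p \<ltimes> z) =
      (?W \<rtimes> m ?X ?Y z) \<circ>\<^sub>A m ?W (?X \<otimes>\<^sub>V ?Y) z \<circ>\<^sub>A (?q \<ltimes> z)"
    by (intro assoc_at_J[of _ _ _ ?k]) (simp_all add: V.hom_iff gamma_unit)
  then show ?thesis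
    by (simp add: gamma_def[of _ _ z] gamma_def[of _ _ "?Y \<star>\<^sub>A z"] whisker_right_comp whisker_left_comp A.assoc
        m_whisker_second m_whisker_first)
qed

text \<open>
  At \<open>y = J\<close>, after \<open>\<eta>\<close>, this is naturality of \<open>lambda\<close> at \<open>\<eta> x\<close> and of \<open>\<eta>\<close> at \<open>lambda x\<close>.
\<close>

lemma lambda_gamma:
  assumes [simp]: "x \<in> Obj A" "y \<in> Obj A"
  shows "lambda (OMap L x \<star>\<^sub>A y) \<circ>\<^sub>A gamma J x y = AMap L (lambda x) \<ltimes> y"
proof -
  let ?X = "OMap L x" and ?k = "OMap L J \<star>\<^sub>A x"
  let ?p = "(unit_comparison \<boxtimes>\<^sub>V Id V ?X) \<circ>\<^sub>V tensor_comparison J x"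
  have "u (?X \<star>\<^sub>A J) \<circ>\<^sub>A m I ?X J \<circ>\<^sub>A (?p \<ltimes> J) \<circ>\<^sub>A \<eta> ?k = lambda (?X \<star>\<^sub>A J) \<circ>\<^sub>A (OMap L J \<rtimes> \<eta> x)"
    by (simp add: lambda_def whisker_right_comp A.assoc tensor_comparison_unit m_whisker_first m_cancel)
  also have "\<dots> = \<eta> x \<circ>\<^sub>A lambda x"
    using lambda_natural[of "\<eta> x"] by simp
  also have "\<dots> = (AMap L (lambda x) \<ltimes> J) \<circ>\<^sub>A \<eta> ?k"
    by (simp add: unit_natural)
  finally have "u (?X \<star>\<^sub>A y) \<circ>\<^sub>A m I ?X y \<circ>\<^sub>A (?p \<ltimes> y) = AMap L (lambda x) \<ltimes> y"
    by (intro lunit_at_J[of _ ?k]) (simp_all add: V.hom_iff)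
  then show ?thesis
    by (simp add: lambda_def gamma_def whisker_right_comp A.assoc m_whisker_first)
qed

text \<open>
  At \<open>y = J\<close>, after \<open>\<eta>\<close>, this is the axiom \<open>lambda_unit\<close> for the unit object, acted on by \<open>L x\<close>.
\<close>

lemma gamma_triangle:
  assumes [simp]: "x \<in> Obj A" "y \<in> Obj A"
  shows "(OMap L x \<rtimes> lambda y) \<circ>\<^sub>A gamma x J y \<circ>\<^sub>A (AMap L (\<eta> x) \<ltimes> y) = Id A (OMap L x \<star>\<^sub>A y)"
proof -
  let ?X = "OMap L x"
  let ?p = "(Id V ?X \<boxtimes>\<^sub>V unit_comparison) \<circ>\<^sub>V tensor_comparison x J \<circ>\<^sub>V AMap L (\<eta> x)"
  have "(?X \<rtimes> u J) \<circ>\<^sub>A m ?X I J \<circ>\<^sub>A (?p \<ltimes> J) \<circ>\<^sub>A \<eta> x = (?X \<rtimes> (lambda J \<circ>\<^sub>A \<eta> J)) \<circ>\<^sub>A \<eta> x"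
    unfolding lambda_def
    by (simp add: whisker_right_comp whisker_left_comp A.assoc unit_natural tensor_comparison_unit m_whisker_second m_cancel)
  then have "(?X \<rtimes> u y) \<circ>\<^sub>A m ?X I y \<circ>\<^sub>A (?p \<ltimes> y) = Id V ?X \<ltimes> y"
    by (intro runit_at_J[of _ x]) (simp_all add: V.hom_iff lambda_unit)
  then show ?thesis
    by (simp add: lambda_def gamma_def whisker_right_comp whisker_left_comp A.assoc m_whisker_second)
qed

text \<open>
  The components of \<open>S\<close> are prescribed on objects only.  This allows both the structure induced by a
  left adjoint and, over the opposite categories, the one induced by a right adjoint to be taken for \<open>S\<close>,
  although their defining expressions are bracketed differently.
\<close>

lemma induced_left_skew_monoidal:
  fixes S :: "('o, 'a) skew"
  assumes ten: "Tensor S = \<lparr>OMap = (\<lambda>(a, b). OMap L a \<star>\<^sub>A b), AMap = (\<lambda>(f, g). AMap F (AMap L f, g))\<rparr>"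
    and unit: "Unit S = J"
    and as: "\<And>a b c. \<lbrakk>a \<in> Obj A; b \<in> Obj A; c \<in> Obj A\<rbrakk> \<Longrightarrow> Assoc S a b c = gamma a b c"
    and lun: "\<And>a. a \<in> Obj A \<Longrightarrow> Lunit S a = lambda a"
    and run: "\<And>a. a \<in> Obj A \<Longrightarrow> Runit S a = \<eta> a"
  shows "left_skew_monoidal A S"
proof -
  have ten_simps [simp]: "OMap (Tensor S) (a, b) = OMap L a \<star>\<^sub>A b"
    "AMap (Tensor S) (f, g) = AMap F (AMap L f, g)" for a b f g
    by (simp_all add: ten)
  note cat = A.category_axioms
  have fct: "is_functor (prod_cat A A) A (Tensor S)"
    by (rule is_functorI) (auto simp: cat category_prod_cat A.hom_iff adj.F.AMap_comp act.interchange)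
  interpret T: bifunctor A A A "Tensor S"
    by (intro bifunctor.intro cat fct)
  show ?thesis
  proof (intro left_skew_monoidal.intro skew_data.intro left_skew_monoidal_axioms.intro
      skew_data_axioms.intro cat fct, goal_cases)
    case 1 then show ?case by (simp add: unit)
  next
    case 2 then show ?case by (simp add: as A.hom_iff)
  next
    case (3 f x x' g y y' h z z')
    then show ?case using gamma_natural[of f g h] by (auto simp: as A.hom_iff)
  next
    case 4 show ?case
      by (rule nat_transI)
        (auto simp: unit lun A.hom_iff lambda_natural is_functor_id cat T.is_functor_fix_fst)
  next
    case 5 show ?case
      by (rule nat_transI)
        (auto simp: unit run A.hom_iff unit_natural is_functor_id cat T.is_functor_fix_snd)
  next
    case (6 w x y z) then show ?case using gamma_pentagon[of w x y z] by (simp add: as)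
  next
    case (7 x y) then show ?case using gamma_unit by (simp add: as unit run)
  next
    case (8 x y) then show ?case using lambda_gamma by (simp add: as unit lun)
  next
    case 9 then show ?case using lambda_unit by (simp add: unit lun run)
  next
    case (10 x y) then show ?case using gamma_triangle[of x y] by (simp add: as unit lun run)
  qed
qed

end


section \<open>Strong actions of a left skew monoidal category\<close>

context strong_left_action
begin

abbreviation "mi x y a \<equiv> inv_arr A (Mult T x y a)"
abbreviation "ui a \<equiv> inv_arr A (Unitor T a)"

lemma Unitor_hom: "a \<in> Obj A \<Longrightarrow> Unitor T a \<in> hom A (Unit S \<star>\<^bsub>T\<^esub> a) a"
  using nat_trans.component_in[OF Unitor_natural] by simp

lemma tensor_action: "tensor_action V A (Tensor S) (Act T) (Unit S) (Mult T) mi (Unitor T) ui"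
proof -
  have bi: "bifunctor V V V (Tensor S)" "bifunctor V A A (Act T)"
    by (intro bifunctor.intro V.category_axioms A.category_axioms V.tensor.is_functor_axioms act.is_functor_axioms)+
  show ?thesis
  proof (intro tensor_action.intro tensor_action_axioms.intro V.category_axioms A.category_axioms bi, goal_cases)
    case 1 then show ?case by (rule V.Unit_in)
  next
    case 2 then show ?case by (rule Mult_in)
  next
    case (3 x y a) then show ?case using A.inv_arr[OF Mult_iso[of x y a]] Mult_in[of x y a] by (simp add: A.hom_iff)
  next
    case (4 x y a) then show ?case using A.inv_arr[OF Mult_iso[of x y a]] Mult_in[of x y a] by (simp add: A.hom_iff)
  next
    case (5 x y a) then show ?case using A.inv_arr[OF Mult_iso[of x y a]] Mult_in[of x y a] by (simp add: A.hom_iff)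
  next
    case (6 f g h) then show ?case by (intro Mult_natural) (auto simp: V.hom_iff A.hom_iff)
  next
    case (7 a) then show ?case by (rule Unitor_hom)
  next
    case (8 a) then show ?case using A.inv_arr[OF Unitor_iso[of a]] Unitor_hom[of a] by (simp add: A.hom_iff)
  next
    case (9 a) then show ?case using A.inv_arr[OF Unitor_iso[of a]] Unitor_hom[of a] by (simp add: A.hom_iff)
  next
    case (10 a) then show ?case using A.inv_arr[OF Unitor_iso[of a]] Unitor_hom[of a] by (simp add: A.hom_iff)
  next
    case (11 h) then show ?case using nat_trans.natural[OF Unitor_natural, of h] by simp
  qed
qed

lemma Lunit_hom: "x \<in> Obj V \<Longrightarrow> Lunit S x \<in> hom V (Unit S \<otimes>\<^bsub>S\<^esub> x) x"
  using nat_trans.component_in[OF V.Lunit_natural] by simp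

lemma Runit_hom: "x \<in> Obj V \<Longrightarrow> Runit S x \<in> hom V x (x \<otimes>\<^bsub>S\<^esub> Unit S)"
  using nat_trans.component_in[OF V.Runit_natural] by simp

text \<open>
  Here the links are the associator and the left and right unitor of \<open>V\<close> themselves.
\<close>

lemma induced_left_is_left_skew:
  assumes "adjunction A V L (act_on A T J) \<eta> \<epsilon>" "J \<in> Obj A"
  shows "left_skew_monoidal A (induced_left V S A T J L \<eta> \<epsilon>)"
proof -
  interpret TA: tensor_action V A "Tensor S" "Act T" "Unit S" "Mult T" mi "Unitor T" ui
    by (rule tensor_action)
  interpret orbit: orbit_adjunction V A "Tensor S" "Act T" "Unit S" "Mult T" mi "Unitor T" ui J L \<eta> \<epsilon>
    using assms by (intro orbit_adjunction.intro orbit_adjunction_axioms.intro tensor_action) (simp_all add: act_on_def)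
  interpret coherent_orbit_adjunction V A "Tensor S" "Act T" "Unit S" "Mult T" mi "Unitor T" ui J L \<eta> \<epsilon>
  proof (unfold_locales, goal_cases)
    case (1 w x y)
    then have "Assoc S w x y \<in> hom V ((w \<otimes>\<^bsub>S\<^esub> x) \<otimes>\<^bsub>S\<^esub> y) (w \<otimes>\<^bsub>S\<^esub> (x \<otimes>\<^bsub>S\<^esub> y))"
      by (rule V.Assoc_in)
    with 1 show ?case
      unfolding TA.linked_def
      by (intro disjI1 bexI[of _ "Assoc S w x y"]) (auto simp: V.hom_iff Mult_Assoc A.assoc)
  next
    case (2 x)
    with Lunit_hom[of x] show ?case
      unfolding TA.linked_def
      by (intro disjI1 bexI[of _ "Lunit S x"]) (auto simp: V.hom_iff Unitor_Mult)
  next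
    case (3 x)
    with Runit_hom[of x] show ?case
      unfolding TA.linked_def
      by (intro disjI2 bexI[of _ "Runit S x"]) (auto simp: V.hom_iff Mult_Runit A.assoc)
  qed
  show ?thesis
  proof (rule induced_left_skew_monoidal)
    fix a assume a: "a \<in> Obj A"
    have "orbit.unit_comparison \<bullet>\<^bsub>T\<^esub> Id A a = (\<epsilon> (Unit S) \<bullet>\<^bsub>T\<^esub> Id A a) \<cdot>\<^bsub>A\<^esub> (AMap L (ui J) \<bullet>\<^bsub>T\<^esub> Id A a)"
      using a assms(2) by (simp add: orbit.unit_comparison_def transpose_left_def TA.whisker_right_comp)
    then show "Lunit (induced_left V S A T J L \<eta> \<epsilon>) a = orbit.lambda a"
      using a by (simp add: induced_left_def orbit.lambda_def)
  qed (simp_all add: induced_left_def pulled_tensor_def orbit.gamma_def orbit.tensor_comparison_def gamma_left_def)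
qed

text \<open>
  In the opposite categories the coherence isomorphisms of the action are inverted and the structural arrows
  of \<open>V\<close> are reversed.  Inverting the action axioms shows that the latter still link the families
  in question, now in the other direction.
\<close>

lemma induced_right_is_right_skew:
  assumes "adjunction V A (act_on A T J) R \<eta> \<epsilon>" "J \<in> Obj A"
  shows "right_skew_monoidal A (induced_right V S A T J R \<eta> \<epsilon>)"
proof (rule right_skew_monoidal_op)
  interpret TA: tensor_action V A "Tensor S" "Act T" "Unit S" "Mult T" mi "Unitor T" ui
    by (rule tensor_action)
  interpret op: tensor_action "op_cat V" "op_cat A" "Tensor S" "Act T" "Unit S" mi "Mult T" ui "Unitor T"
    by (rule tensor_action_op[OF tensor_action])
  interpret adj: adjunction V A "fix_snd A (Act T) J" R \<eta> \<epsilon>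
    using assms by (simp add: act_on_def)
  interpret orbit: orbit_adjunction "op_cat V" "op_cat A" "Tensor S" "Act T" "Unit S" mi "Mult T" ui "Unitor T" J R \<epsilon> \<eta>
    using assms adjunction_op[OF adj.adjunction_axioms]
    by (intro orbit_adjunction.intro orbit_adjunction_axioms.intro op.tensor_action_axioms) simp_all
  interpret coherent_orbit_adjunction "op_cat V" "op_cat A" "Tensor S" "Act T" "Unit S" mi "Mult T" ui "Unitor T" J R \<epsilon> \<eta>
  proof (unfold_locales, goal_cases)
    case (1 w x y)
    then have [simp]: "w \<in> Obj V" "x \<in> Obj V" "y \<in> Obj V"
      by simp_all
    have as: "Assoc S w x y \<in> hom V ((w \<otimes>\<^bsub>S\<^esub> x) \<otimes>\<^bsub>S\<^esub> y) (w \<otimes>\<^bsub>S\<^esub> (x \<otimes>\<^bsub>S\<^esub> y))"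
      by (rule V.Assoc_in) simp_all
    have "(Assoc S w x y \<bullet>\<^bsub>T\<^esub> Id A c) \<cdot>\<^bsub>A\<^esub> (mi (w \<otimes>\<^bsub>S\<^esub> x) y c \<cdot>\<^bsub>A\<^esub> mi w x (y \<star>\<^bsub>T\<^esub> c)) =
        mi w (x \<otimes>\<^bsub>S\<^esub> y) c \<cdot>\<^bsub>A\<^esub> (Id V w \<bullet>\<^bsub>T\<^esub> mi x y c)" if [simp]: "c \<in> Obj A" for c
    proof (rule A.factor_inverse)
      show "((Id V w \<bullet>\<^bsub>T\<^esub> Mult T x y c) \<cdot>\<^bsub>A\<^esub> Mult T w (x \<otimes>\<^bsub>S\<^esub> y) c) \<cdot>\<^bsub>A\<^esub> (Assoc S w x y \<bullet>\<^bsub>T\<^esub> Id A c) =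
          Mult T w x (y \<star>\<^bsub>T\<^esub> c) \<cdot>\<^bsub>A\<^esub> Mult T (w \<otimes>\<^bsub>S\<^esub> x) y c"
        using as by (simp add: V.hom_iff A.assoc Mult_Assoc)
    qed (use as in \<open>simp_all add: V.hom_iff A.assoc TA.m_cancel TA.m_mi A.iso_arr_comp TA.iso_m
        TA.iso_whisker_left TA.act.interchange\<close>)
    with as show ?case
      unfolding op.linked_def by (intro disjI2 bexI[of _ "Assoc S w x y"]) auto
  next
    case (2 x)
    then have [simp]: "x \<in> Obj V" by simp
    note l = Lunit_hom[of x, simplified]
    have "(Lunit S x \<bullet>\<^bsub>T\<^esub> Id A c) \<cdot>\<^bsub>A\<^esub> (mi (Unit S) x c \<cdot>\<^bsub>A\<^esub> ui (x \<star>\<^bsub>T\<^esub> c)) = Id A (x \<star>\<^bsub>T\<^esub> c)"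
      if [simp]: "c \<in> Obj A" for c
    proof (rule A.factor_inverse)
      show "Id A (x \<star>\<^bsub>T\<^esub> c) \<cdot>\<^bsub>A\<^esub> (Lunit S x \<bullet>\<^bsub>T\<^esub> Id A c) = Unitor T (x \<star>\<^bsub>T\<^esub> c) \<cdot>\<^bsub>A\<^esub> Mult T (Unit S) x c"
        using l by (simp add: V.hom_iff Unitor_Mult)
    qed (use l in \<open>simp_all add: V.hom_iff A.assoc TA.m_cancel TA.u_ui A.iso_arr_Id\<close>)
    with l show ?case
      unfolding op.linked_def by (intro disjI2 bexI[of _ "Lunit S x"]) auto
  next
    case (3 x)
    then have [simp]: "x \<in> Obj V" by simp
    note r = Runit_hom[of x, simplified]
    have "(Runit S x \<bullet>\<^bsub>T\<^esub> Id A c) \<cdot>\<^bsub>A\<^esub> Id A (x \<star>\<^bsub>T\<^esub> c) =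
        mi x (Unit S) c \<cdot>\<^bsub>A\<^esub> (Id V x \<bullet>\<^bsub>T\<^esub> ui c)" if [simp]: "c \<in> Obj A" for c
    proof (rule A.factor_inverse)
      show "((Id V x \<bullet>\<^bsub>T\<^esub> Unitor T c) \<cdot>\<^bsub>A\<^esub> Mult T x (Unit S) c) \<cdot>\<^bsub>A\<^esub> (Runit S x \<bullet>\<^bsub>T\<^esub> Id A c) = Id A (x \<star>\<^bsub>T\<^esub> c)"
        using r by (simp add: V.hom_iff A.assoc Mult_Runit)
    qed (use r in \<open>simp_all add: V.hom_iff A.assoc TA.m_cancel TA.u_ui A.iso_arr_comp TA.iso_m TA.iso_u
        TA.iso_whisker_left TA.act.interchange\<close>)
    with r show ?case
      unfolding op.linked_def by (intro disjI1 bexI[of _ "Runit S x"]) auto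
  qed
  show "left_skew_monoidal (op_cat A) (induced_right V S A T J R \<eta> \<epsilon>)"
  proof (rule induced_left_skew_monoidal)
    fix a b c assume abc: "a \<in> Obj (op_cat A)" "b \<in> Obj (op_cat A)" "c \<in> Obj (op_cat A)"
    then show "Assoc (induced_right V S A T J R \<eta> \<epsilon>) a b c = orbit.gamma a b c"
      by (simp add: induced_right_def orbit.gamma_def orbit.tensor_comparison_def gamma_right_def transpose_left_def transpose_right_def)
  next
    fix a assume "a \<in> Obj (op_cat A)"
    then show "Lunit (induced_right V S A T J R \<eta> \<epsilon>) a = orbit.lambda a"
      using assms(2)
      by (simp add: induced_right_def orbit.lambda_def orbit.unit_comparison_def transpose_left_def TA.whisker_right_comp A.assoc)
  qed (simp_all add: induced_right_def pulled_tensor_def)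
qed

lemma fix_snd_pulled_tensor: "fix_snd A (pulled_tensor T K) b = act_on A T b \<circ>\<^sub>F K"
  by (simp add: fix_snd_def pulled_tensor_def act_on_def comp_fctr_def)

lemma fix_fst_pulled_tensor:
  assumes "is_functor A V K" "a \<in> Obj A"
  shows "fix_fst A (pulled_tensor T K) a = act_by V T (OMap K a)"
  using is_functor.AMap_Id[OF assms] by (simp add: fix_fst_def pulled_tensor_def act_by_def)

end

theorem proposition7p3:
  fixes V :: "('vo, 'va) cat" and S :: "('vo, 'va) skew"
    and A :: "('o, 'a) cat" and T :: "('vo, 'va, 'o, 'a) action" and J :: 'o
  assumes "left_skew_monoidal V S"
    and "strong_left_action V S A T"
    and "J \<in> Obj A"
  shows
    "(\<forall>L \<eta> \<epsilon>. adjunction A V L (act_on A T J) \<eta> \<epsilon> \<longrightarrow>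
        left_skew_monoidal A (induced_left V S A T J L \<eta> \<epsilon>) \<and>
        (action_left_closed V A T \<longrightarrow>
          skew_left_closed A (induced_left V S A T J L \<eta> \<epsilon>) \<and>
          (\<forall>B \<in> Obj A. \<forall>B_sharp. right_adjoint V A (act_on A T B) B_sharp \<longrightarrow>
            right_adjoint A A (fix_snd A (Tensor (induced_left V S A T J L \<eta> \<epsilon>)) B)
              (act_on A T J \<circ>\<^sub>F B_sharp))) \<and>
        (action_right_closed V A T \<longrightarrow>
          skew_right_closed A (induced_left V S A T J L \<eta> \<epsilon>) \<and>
          (\<forall>B \<in> Obj A. \<forall>H. right_adjoint A A (act_by V T (OMap L B)) H \<longrightarrow>
            right_adjoint A A (fix_fst A (Tensor (induced_left V S A T J L \<eta> \<epsilon>)) B) H)))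
     \<and>
     (\<forall>R \<eta> \<epsilon>. adjunction V A (act_on A T J) R \<eta> \<epsilon> \<longrightarrow>
        right_skew_monoidal A (induced_right V S A T J R \<eta> \<epsilon>) \<and>
        (\<forall>R_J. action_left_closed V A T \<and> right_adjoint A V R R_J \<longrightarrow>
          skew_left_closed A (induced_right V S A T J R \<eta> \<epsilon>) \<and>
          (\<forall>B \<in> Obj A. \<forall>B_sharp. right_adjoint V A (act_on A T B) B_sharp \<longrightarrow>
            right_adjoint A A (fix_snd A (Tensor (induced_right V S A T J R \<eta> \<epsilon>)) B)
              (R_J \<circ>\<^sub>F B_sharp))) \<and>
        (action_right_closed V A T \<longrightarrow>
          skew_right_closed A (induced_right V S A T J R \<eta> \<epsilon>) \<and>
          (\<forall>B \<in> Obj A. \<forall>H. right_adjoint A A (act_by V T (OMap R B)) H \<longrightarrow>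
            right_adjoint A A (fix_fst A (Tensor (induced_right V S A T J R \<eta> \<epsilon>)) B) H)))"
proof (intro conjI allI impI ballI)
  interpret strong_left_action V S A T by fact
  {
    fix L \<eta> \<epsilon> assume adj: "adjunction A V L (act_on A T J) \<eta> \<epsilon>"
    let ?S = "induced_left V S A T J L \<eta> \<epsilon>"
    have J: "right_adjoint A V L (act_on A T J)"
      using adj by (auto simp: right_adjoint_def)
    have L: "is_functor A V L"
      using adj by (simp add: adjunction_def)
    have ten: "Tensor ?S = pulled_tensor T L"
      by (simp add: induced_left_def)
    show "left_skew_monoidal A ?S"
      by (rule induced_left_is_left_skew[OF adj \<open>J \<in> Obj A\<close>])
    show snd: "right_adjoint A A (fix_snd A (Tensor ?S) B) (act_on A T J \<circ>\<^sub>F B_sharp)"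
      if "right_adjoint V A (act_on A T B) B_sharp" for B B_sharp
      unfolding ten fix_snd_pulled_tensor using J that by (rule right_adjoint_comp)
    show fst: "right_adjoint A A (fix_fst A (Tensor ?S) B) H"
      if "B \<in> Obj A" "right_adjoint A A (act_by V T (OMap L B)) H" for B H
      unfolding ten fix_fst_pulled_tensor[OF L that(1)] by (rule that(2))
    show "skew_left_closed A ?S" if "action_left_closed V A T"
      using that snd unfolding skew_left_closed_def action_left_closed_def by blast
    show "skew_right_closed A ?S" if "action_right_closed V A T"
      using that fst is_functor.OMap_in[OF L] unfolding skew_right_closed_def action_right_closed_def by blast
  }
  {
    fix R \<eta> \<epsilon> assume adj: "adjunction V A (act_on A T J) R \<eta> \<epsilon>"
    let ?S = "induced_right V S A T J R \<eta> \<epsilon>"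
    have R: "is_functor A V R"
      using adj by (simp add: adjunction_def)
    have ten: "Tensor ?S = pulled_tensor T R"
      by (simp add: induced_right_def)
    show "right_skew_monoidal A ?S"
      by (rule induced_right_is_right_skew[OF adj \<open>J \<in> Obj A\<close>])
    have snd: "right_adjoint A A (fix_snd A (Tensor ?S) B) (R_J \<circ>\<^sub>F B_sharp)"
      if "right_adjoint A V R R_J" "right_adjoint V A (act_on A T B) B_sharp" for B R_J B_sharp
      unfolding ten fix_snd_pulled_tensor using that by (rule right_adjoint_comp)
    show "right_adjoint A A (fix_snd A (Tensor ?S) B) (R_J \<circ>\<^sub>F B_sharp)"
      if "action_left_closed V A T \<and> right_adjoint A V R R_J" "right_adjoint V A (act_on A T B) B_sharp"
      for B R_J B_sharp
      using that by (intro snd) simp_all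
    show "skew_left_closed A ?S" if "action_left_closed V A T \<and> right_adjoint A V R R_J" for R_J
      using that snd unfolding skew_left_closed_def action_left_closed_def by blast
    show fst: "right_adjoint A A (fix_fst A (Tensor ?S) B) H"
      if "B \<in> Obj A" "right_adjoint A A (act_by V T (OMap R B)) H" for B H
      unfolding ten fix_fst_pulled_tensor[OF R that(1)] by (rule that(2))
    show "skew_right_closed A ?S" if "action_right_closed V A T"
      using that fst is_functor.OMap_in[OF R] unfolding skew_right_closed_def action_right_closed_def by blast
  }
qed

end
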